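(* Let $K$ be an algebraically closed field of characteristic $2$ and let $d\ge 1$ be an integer. Then the Artinian complete intersection $A:=K[X,Y,Z]/(X^d,Y^d,Z^d)$ has the weak Lefschetz property if and only if $d=\left\lfloor \frac{2^t+1}{3}\right\rfloor$ for some positive integer $t$.
   Context: Weak Lefschetz property: let $R=K[X,Y,Z]$ with the standard grading, $K$ an algebraically closed field, and let $A=R/I$ be a graded Artinian quotient, $A=K\oplus A_1\oplus\cdots\oplus A_s$ with $A_m$ the degree-$m$ component and $A_m=0$ for $m>s$. $A$ has the weak Lefschetz property if for a general linear form $\ell\in R_1$ (i.e. for all $\ell$ in some nonempty Zariski-open subset of $R_1$) the multiplication maps $A_m\to A_{m+1}$, $a\mapsto \ell a$, have maximal rank (are injective or surjective) for all $m=0,\ldots,s-1$. *)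

theory Defs
  imports
    "HOL-Library.Poly_Mapping"
    "HOL-Algebra.QuotRing"
    "HOL-Algebra.Algebraic_Closure_Type"
begin

datatype var = VX | VY | VZ

text \<open>
  A monomial is its exponent vector, and the polynomial ring in the three variables is the
  monoid algebra over the monomials, whose ring operations come from the library instance for
  \<^type>\<open>poly_mapping\<close>.
\<close>

type_synonym monomial = "var \<Rightarrow>\<^sub>0 nat"
type_synonym 'k poly3 = "monomial \<Rightarrow>\<^sub>0 'k"

abbreviation poly_ring :: "'k::field poly3 ring" where
  "poly_ring \<equiv> ring_of_type_algebra"

definition Var :: "var \<Rightarrow> 'k::field poly3" where
  "Var i = Poly_Mapping.single (Poly_Mapping.single i 1) 1"

definition mdeg :: "monomial \<Rightarrow> nat" where
  "mdeg \<alpha> = (\<Sum>i\<in>Poly_Mapping.keys \<alpha>. Poly_Mapping.lookup \<alpha> i)"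

text \<open>The zero polynomial belongs to every \<^term>\<open>forms m\<close>.\<close>

definition forms :: "nat \<Rightarrow> 'k::field poly3 set" where
  "forms m = {f. \<forall>\<alpha>\<in>Poly_Mapping.keys f. mdeg \<alpha> = m}"

definition eval_poly :: "'k::field poly3 \<Rightarrow> (var \<Rightarrow> 'k) \<Rightarrow> 'k" where
  "eval_poly p v = (\<Sum>\<alpha>\<in>Poly_Mapping.keys p. Poly_Mapping.lookup p \<alpha> *
     (\<Prod>i\<in>Poly_Mapping.keys \<alpha>. v i ^ Poly_Mapping.lookup \<alpha> i))"

text \<open>
  The Zariski topology on the space of linear forms \<open>a X + b Y + c Z\<close> is that of affine
  three-space with coordinates \<open>(a, b, c)\<close>; the type \<^typ>\<open>'k poly3\<close> is used a second time, for
  the polynomial functions in these coordinates.  The closed sets are the common zero loci of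
  arbitrary sets \<open>S\<close> of polynomials.
\<close>

definition linear_coeffs :: "'k::field poly3 \<Rightarrow> var \<Rightarrow> 'k" where
  "linear_coeffs l i = Poly_Mapping.lookup l (Poly_Mapping.single i 1)"

definition zariski_open_linear :: "'k::field poly3 set \<Rightarrow> bool" where
  "zariski_open_linear U \<longleftrightarrow>
     (\<exists>S. U = forms 1 - {l \<in> forms 1. \<forall>p\<in>S. eval_poly p (linear_coeffs l) = 0})"

text \<open>
  For a homogeneous ideal \<open>I\<close>, the degree-\<open>m\<close> component of the quotient by \<open>I\<close> consists of the
  residue classes of the forms of degree \<open>m\<close>.
\<close>

definition quot_component :: "'k::field poly3 set \<Rightarrow> nat \<Rightarrow> 'k poly3 set set" where
  "quot_component I m = (\<lambda>f. I +>\<^bsub>poly_ring\<^esub> f) ` forms m"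

definition quot_mult :: "'k::field poly3 set \<Rightarrow> 'k poly3 \<Rightarrow> 'k poly3 set \<Rightarrow> 'k poly3 set" where
  "quot_mult I l a = (I +>\<^bsub>poly_ring\<^esub> l) \<otimes>\<^bsub>poly_ring Quot I\<^esub> a"

definition max_rank_at :: "'k::field poly3 set \<Rightarrow> 'k poly3 \<Rightarrow> nat \<Rightarrow> bool" where
  "max_rank_at I l m \<longleftrightarrow>
     inj_on (quot_mult I l) (quot_component I m) \<or>
     quot_mult I l ` quot_component I m = quot_component I (Suc m)"

text \<open>
  The bound \<open>s\<close> witnesses that the quotient by the homogeneous ideal \<open>I\<close> is Artinian.  Which
  bound is chosen is immaterial, since a map onto the zero component is surjective.
\<close>

definition weak_lefschetz :: "'k::field poly3 set \<Rightarrow> bool" where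
  "weak_lefschetz I \<longleftrightarrow>
     (\<exists>s. (\<forall>m>s. quot_component I m = {\<zero>\<^bsub>poly_ring Quot I\<^esub>}) \<and>
          (\<exists>U. zariski_open_linear U \<and> U \<noteq> {} \<and> (\<forall>l\<in>U. \<forall>m<s. max_rank_at I l m)))"

definition power_ideal :: "nat \<Rightarrow> 'k::field poly3 set" where
  "power_ideal d = Idl\<^bsub>poly_ring\<^esub> {Var VX ^ d, Var VY ^ d, Var VZ ^ d}"

end

theory Submission
  imports Defs
begin

text \<open>
  Let \<open>I = (X\<^sup>d, Y\<^sup>d, Z\<^sup>d)\<close> and \<open>A = R/I\<close>, a Gorenstein algebra whose socle is spanned by
  \<open>(XYZ)\<^bsup>d-1\<^esup>\<close> in degree \<open>3d - 3\<close>.  The coefficient of that monomial turns multiplication into a perfect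
  pairing, so multiplication by a linear form \<open>\<ell>\<close> is surjective in degree \<open>m\<close> exactly if it is injective
  in degree \<open>3d - 4 - m\<close> (lemmas \<open>mult_injective_of_surjective\<close> and \<open>mult_surjective_of_injective\<close>).  As
  injectivity passes to lower degrees, for \<open>d \<ge> 2\<close> all maps have maximal rank if and only if multiplication by
  \<open>\<ell>\<close> is injective in the single degree \<open>\<lfloor>(3d - 4)/2\<rfloor>\<close>; this is \<open>max_rank_all_iff\<close>.

  Write \<open>d = q + r\<close> with \<open>q\<close> a power of \<open>2\<close> and \<open>q \<le> d \<le> 2q\<close>.  In characteristic \<open>2\<close> the power \<open>\<ell>\<^sup>q\<close> is
  a combination of \<open>X\<^sup>q\<close>, \<open>Y\<^sup>q\<close>, \<open>Z\<^sup>q\<close>, whence \<open>\<ell>\<^bsup>2q\<^esup> \<in> I\<close> and \<open>\<ell>\<^sup>q (XYZ)\<^sup>r \<in> I\<close>.  Consequently \<open>\<ell>\<close>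
  annihilates nonzero classes in \<open>A\<close> of degree at most \<open>2q - 1\<close> and of degree at most \<open>q - 1 + 3r\<close>.  One of
  them lies in degree at most \<open>\<lfloor>(3d - 4)/2\<rfloor>\<close> unless \<open>\<bar>3d - 4q\<bar> \<le> 1\<close>, which is the condition on \<open>d\<close> in the
  theorem for \<open>2\<^sup>t = 4q\<close>.  This is true of every linear form \<open>\<ell>\<close>
  (\<open>injective_imp_near_power\<close>).

  Conversely let all three coefficients of \<open>\<ell>\<close> be nonzero.  Modulo \<open>\<ell>\<close>, after rescaling and
  dehomogenizing, the three powers become \<open>x\<^sup>d\<close>, \<open>1\<close> and \<open>(x + 1)\<^sup>d\<close>.  An element of the kernel of \<open>\<ell>\<close>
  produces a syzygy of these.  The two annihilation relations above are the syzygies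
  \<open>S\<^sub>1 = (x\<^bsup>2q-d\<^esup>, 1, (x+1)\<^bsup>2q-d\<^esup>)\<close> and \<open>S\<^sub>2 = ((x+1)\<^sup>r, x\<^sup>r (x+1)\<^sup>r, x\<^sup>r)\<close>, whose cross product is the vector
  \<open>(x\<^sup>d, 1, (x+1)\<^sup>d)\<close> itself; so they generate the syzygy module, and there is no syzygy of degree below both
  of theirs (\<open>no_low_degree_syzygy\<close>).  If \<open>\<bar>3d - 4q\<bar> \<le> 1\<close>, kernel elements in degree \<open>\<lfloor>(3d - 4)/2\<rfloor>\<close> have
  syzygies of such a low degree, and are therefore zero in \<open>A\<close> (\<open>near_power_imp_injective\<close>).
\<close>

section \<open>Monomials and forms\<close>

lemma var_UNIV: "(UNIV :: var set) = {VX, VY, VZ}"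
  using var.exhaust by auto

instance var :: finite
  by standard (simp add: var_UNIV)

text \<open>
  A linear order on the variables induces a lexicographic order on the monomials.  It is what makes the
  polynomial ring an integral domain by the instances for \<^type>\<open>poly_mapping\<close>.
\<close>

instantiation var :: linorder
begin

fun var_index :: "var \<Rightarrow> nat" where
  "var_index VX = 0" | "var_index VY = 1" | "var_index VZ = 2"

definition less_eq_var :: "var \<Rightarrow> var \<Rightarrow> bool" where
  "i \<le> j \<longleftrightarrow> var_index i \<le> var_index j"

definition less_var :: "var \<Rightarrow> var \<Rightarrow> bool" where
  "i < j \<longleftrightarrow> var_index i < var_index j"

instance
proof
  fix i j :: var
  show "i \<le> j \<Longrightarrow> j \<le> i \<Longrightarrow> i = j"
    by (cases i; cases j) (simp_all add: less_eq_var_def)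
qed (auto simp: less_eq_var_def less_var_def)

end

abbreviation coeff_at :: "'k::field poly3 \<Rightarrow> monomial \<Rightarrow> 'k" where
  "coeff_at \<equiv> Poly_Mapping.lookup"

abbreviation expo :: "monomial \<Rightarrow> var \<Rightarrow> nat" where
  "expo \<equiv> Poly_Mapping.lookup"

abbreviation cmon :: "monomial \<Rightarrow> 'k::field \<Rightarrow> 'k poly3" where
  "cmon \<equiv> Poly_Mapping.single"

lemma poly3_sum_terms: "p = (\<Sum>\<alpha>\<in>Poly_Mapping.keys p. cmon \<alpha> (coeff_at p \<alpha>))"
proof (rule poly_mapping_eqI)
  fix \<gamma>
  show "coeff_at p \<gamma> = coeff_at (\<Sum>\<alpha>\<in>Poly_Mapping.keys p. cmon \<alpha> (coeff_at p \<alpha>)) \<gamma>"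
    by (auto simp: lookup_sum lookup_single when_def sum.delta' in_keys_iff)
qed

lemma poly3_terms_induct [case_names zero add single]:
  assumes "P 0"
    and "\<And>f g. P f \<Longrightarrow> P g \<Longrightarrow> P (f + g)"
    and "\<And>\<alpha> c. \<alpha> \<in> Poly_Mapping.keys p \<Longrightarrow> P (cmon \<alpha> c)"
  shows "P p"
proof -
  have "P (\<Sum>\<alpha>\<in>A. cmon \<alpha> (coeff_at p \<alpha>))" if "finite A" "A \<subseteq> Poly_Mapping.keys p" for A
    using that by (induction A rule: finite_induct) (auto intro: assms)
  from this[of "Poly_Mapping.keys p"] show ?thesis
    by (simp flip: poly3_sum_terms)
qed

lemma monomial_eqI:
  assumes "expo \<alpha> VX = expo \<beta> VX" "expo \<alpha> VY = expo \<beta> VY" "expo \<alpha> VZ = expo \<beta> VZ"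
  shows "\<alpha> = \<beta>"
proof (rule poly_mapping_eqI)
  show "expo \<alpha> i = expo \<beta> i" for i
    using assms by (cases i) auto
qed

lemma single_var_eq_iff: "Poly_Mapping.single i (Suc 0) = Poly_Mapping.single j (Suc 0) \<longleftrightarrow> i = j"
  by (metis lookup_single_eq lookup_single_not_eq nat.distinct(1))

lemma mdeg_eq: "mdeg \<alpha> = expo \<alpha> VX + expo \<alpha> VY + expo \<alpha> VZ"
proof -
  have "mdeg \<alpha> = (\<Sum>i\<in>UNIV. expo \<alpha> i)"
    unfolding mdeg_def by (intro sum.mono_neutral_left) (auto simp: in_keys_iff)
  then show ?thesis by (simp add: var_UNIV add.assoc)
qed

lemma mdeg_add: "mdeg (\<alpha> + \<beta>) = mdeg \<alpha> + mdeg \<beta>"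
  by (simp add: mdeg_eq lookup_add)

lemma mdeg_zero [simp]: "mdeg 0 = 0"
  by (simp add: mdeg_eq)

lemma mdeg_single [simp]: "mdeg (Poly_Mapping.single i n) = n"
  by (cases i) (simp_all add: mdeg_eq lookup_single)

lemma forms_zero [simp]: "0 \<in> forms m"
  by (simp add: forms_def)

lemma forms_add: "f \<in> forms m \<Longrightarrow> g \<in> forms m \<Longrightarrow> f + g \<in> forms m"
  using keys_add[of f g] by (auto simp: forms_def)

lemma forms_cmon: "mdeg \<alpha> = m \<Longrightarrow> cmon \<alpha> c \<in> forms m"
  by (auto simp: forms_def)

lemma forms_mult: "f \<in> forms m \<Longrightarrow> g \<in> forms n \<Longrightarrow> f * g \<in> forms (m + n)"
  using keys_mult[of f g] by (fastforce simp: forms_def mdeg_add)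

lemma forms_diff:
  assumes "f \<in> forms m" and "g \<in> forms m"
  shows "f - g \<in> forms m"
proof -
  have "\<alpha> \<in> Poly_Mapping.keys f \<or> \<alpha> \<in> Poly_Mapping.keys g"
    if "\<alpha> \<in> Poly_Mapping.keys (f - g)" for \<alpha>
    using that by (auto simp: in_keys_iff lookup_minus)
  with assms show ?thesis
    by (auto simp: forms_def)
qed

lemma forms_power: "f \<in> forms m \<Longrightarrow> f ^ n \<in> forms (n * m)"
  by (induction n) (auto intro: forms_mult simp: forms_cmon simp flip: single_one)

lemma forms_key_mdeg: "f \<in> forms m \<Longrightarrow> \<alpha> \<in> Poly_Mapping.keys f \<Longrightarrow> mdeg \<alpha> = m"
  by (simp add: forms_def)

lemma Var_power: "(Var i :: 'k::field poly3) ^ n = cmon (Poly_Mapping.single i n) 1"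
  by (induction n) (simp_all add: Var_def mult_single flip: single_add)

lemma coeff_mult_cmon:
  "coeff_at (f * cmon \<beta> c) (\<alpha> + \<beta>) = coeff_at f \<alpha> * c"
proof (induction f rule: poly3_terms_induct)
  case (single \<gamma> a)
  then show ?case
    by (auto simp: mult_single lookup_single when_def)
qed (simp_all add: lookup_add algebra_simps)

lemma linear_form_eq:
  fixes l :: "'k::field poly3"
  assumes "l \<in> forms 1"
  shows "l = cmon (Poly_Mapping.single VX 1) (linear_coeffs l VX)
           + cmon (Poly_Mapping.single VY 1) (linear_coeffs l VY)
           + cmon (Poly_Mapping.single VZ 1) (linear_coeffs l VZ)" (is "l = ?r")
proof (rule poly_mapping_eqI)
  fix \<alpha> :: monomial
  show "coeff_at l \<alpha> = coeff_at ?r \<alpha>"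
  proof (cases "mdeg \<alpha> = 1")
    case True
    then consider "expo \<alpha> VX = 1" "expo \<alpha> VY = 0" "expo \<alpha> VZ = 0"
      | "expo \<alpha> VX = 0" "expo \<alpha> VY = 1" "expo \<alpha> VZ = 0"
      | "expo \<alpha> VX = 0" "expo \<alpha> VY = 0" "expo \<alpha> VZ = 1"
      unfolding mdeg_eq by linarith
    then have "\<alpha> \<in> range (\<lambda>i. Poly_Mapping.single i 1)"
    proof cases
      case 1
      then have "\<alpha> = Poly_Mapping.single VX 1"
        by (intro monomial_eqI) (simp_all add: lookup_single)
      then show ?thesis by simp
    next
      case 2
      then have "\<alpha> = Poly_Mapping.single VY 1"
        by (intro monomial_eqI) (simp_all add: lookup_single)
      then show ?thesis by simp
    next
      case 3
      then have "\<alpha> = Poly_Mapping.single VZ 1"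
        by (intro monomial_eqI) (simp_all add: lookup_single)
      then show ?thesis by simp
    qed
    then obtain i where "\<alpha> = Poly_Mapping.single i 1"
      by blast
    then show ?thesis
      by (cases i) (simp_all add: lookup_add lookup_single linear_coeffs_def when_def single_var_eq_iff)
  next
    case False
    then have "coeff_at l \<alpha> = 0"
      using assms by (auto simp: forms_def in_keys_iff)
    moreover have "\<alpha> \<noteq> Poly_Mapping.single i 1" for i
      using False by auto
    ultimately show ?thesis
      by (auto simp: lookup_add lookup_single when_def)
  qed
qed

section \<open>The ideal generated by the powers\<close>

lemma power_ideal_ideal: "ideal (power_ideal d :: 'k::field poly3 set) poly_ring"
  unfolding power_ideal_def
  by (rule ring.genideal_ideal[OF ring_from_type_algebra]) (simp add: ring_of_type_algebra_def)

lemma power_ideal_zero [simp]: "0 \<in> (power_ideal d :: 'k::field poly3 set)"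
  using additive_subgroup.zero_closed[OF ideal.axioms(1)[OF power_ideal_ideal[of d]]]
  by (simp add: ring_of_type_algebra_def)

lemma power_ideal_add:
  "f \<in> power_ideal d \<Longrightarrow> g \<in> power_ideal d \<Longrightarrow> f + g \<in> (power_ideal d :: 'k::field poly3 set)"
  using additive_subgroup.a_closed[OF ideal.axioms(1)[OF power_ideal_ideal[of d]], of f g]
  by (simp add: ring_of_type_algebra_def)

lemma power_ideal_mult:
  "f \<in> power_ideal d \<Longrightarrow> g * f \<in> (power_ideal d :: 'k::field poly3 set)"
  using ideal.I_l_closed[OF power_ideal_ideal[of d], of f g]
  by (simp add: ring_of_type_algebra_def)

lemma power_ideal_mult_left:
  "f \<in> power_ideal d \<Longrightarrow> f * g \<in> (power_ideal d :: 'k::field poly3 set)"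
  using power_ideal_mult[of f d g] by (simp add: mult.commute)

lemma power_ideal_uminus:
  "f \<in> power_ideal d \<Longrightarrow> - f \<in> (power_ideal d :: 'k::field poly3 set)"
  using power_ideal_mult[of f d "-1"] by simp

lemma power_ideal_diff:
  "f \<in> power_ideal d \<Longrightarrow> g \<in> power_ideal d \<Longrightarrow> f - g \<in> (power_ideal d :: 'k::field poly3 set)"
  using power_ideal_add[of f d "- g"] power_ideal_uminus by auto

lemma Var_power_in_power_ideal: "Var i ^ d \<in> (power_ideal d :: 'k::field poly3 set)"
proof -
  have "{Var VX ^ d, Var VY ^ d, Var VZ ^ d} \<subseteq> (power_ideal d :: 'k poly3 set)"
    unfolding power_ideal_def
    by (rule ring.genideal_self[OF ring_from_type_algebra]) (simp add: ring_of_type_algebra_def)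
  then show ?thesis
    by (cases i) auto
qed

lemma term_eq_mult_Var_power:
  assumes "d \<le> expo \<alpha> i"
  shows "cmon \<alpha> c = cmon (\<alpha> - Poly_Mapping.single i d) c * Var i ^ d"
proof -
  have "\<alpha> = (\<alpha> - Poly_Mapping.single i d) + Poly_Mapping.single i d"
    by (rule poly_mapping_eqI) (use assms in \<open>auto simp: lookup_add lookup_minus lookup_single when_def\<close>)
  then show ?thesis
    by (simp add: Var_power mult_single)
qed

text \<open>
  The right-hand side describes an ideal because multiplication only raises exponents; hence it contains
  the generated ideal.
\<close>

lemma power_ideal_iff:
  fixes f :: "'k::field poly3"
  shows "f \<in> power_ideal d \<longleftrightarrow> (\<forall>\<alpha>\<in>Poly_Mapping.keys f. \<exists>i. d \<le> expo \<alpha> i)"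
proof
  let ?J = "{f :: 'k poly3. \<forall>\<alpha>\<in>Poly_Mapping.keys f. \<exists>i. d \<le> expo \<alpha> i}"
  interpret R: cring "poly_ring :: 'k poly3 ring"
    by (rule cring_from_type_algebra)
  have add: "f + g \<in> ?J" if "f \<in> ?J" "g \<in> ?J" for f g
    using that keys_add[of f g] by blast
  have mult: "f * g \<in> ?J" if "g \<in> ?J" for f g
    using that keys_mult[of f g] by (fastforce simp: lookup_add intro: trans_le_add2)
  have "ideal ?J poly_ring"
  proof (intro idealI)
    show "subgroup ?J (add_monoid (poly_ring :: 'k poly3 ring))"
    proof
      show "inv\<^bsub>add_monoid poly_ring\<^esub> f \<in> ?J" if "f \<in> ?J" for f
      proof -
        have "inv\<^bsub>add_monoid poly_ring\<^esub> f = - f"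
          using R.minus_equality[of "- f" f] by (simp add: ring_of_type_algebra_def a_inv_def)
        with mult[OF that, of "- 1"] show ?thesis by simp
      qed
    next
      fix f g assume "f \<in> ?J" "g \<in> ?J"
      then show "f \<otimes>\<^bsub>add_monoid poly_ring\<^esub> g \<in> ?J"
        using add[of f g] by (simp add: ring_of_type_algebra_def)
    qed (simp_all add: ring_of_type_algebra_def)
  next
    fix f g assume "f \<in> ?J"
    then show "g \<otimes>\<^bsub>poly_ring\<^esub> f \<in> ?J" "f \<otimes>\<^bsub>poly_ring\<^esub> g \<in> ?J"
      using mult[of f g] by (simp_all add: ring_of_type_algebra_def mult.commute)
  qed (rule R.ring_axioms)
  moreover have "Var i ^ d \<in> ?J" for i
    by (auto simp: Var_power intro!: exI[of _ i])
  ultimately have "power_ideal d \<subseteq> ?J"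
    unfolding power_ideal_def by (intro R.genideal_minimal) auto
  then show "\<forall>\<alpha>\<in>Poly_Mapping.keys f. \<exists>i. d \<le> expo \<alpha> i" if "f \<in> power_ideal d"
    using that by auto
next
  assume *: "\<forall>\<alpha>\<in>Poly_Mapping.keys f. \<exists>i. d \<le> expo \<alpha> i"
  show "f \<in> power_ideal d"
  proof (rule poly3_terms_induct[where p = f])
    fix \<alpha> c
    assume "\<alpha> \<in> Poly_Mapping.keys f"
    with * obtain i where "d \<le> expo \<alpha> i"
      by blast
    then show "cmon \<alpha> c \<in> power_ideal d"
      by (simp add: term_eq_mult_Var_power power_ideal_mult Var_power_in_power_ideal)
  qed (auto intro: power_ideal_add)
qed

section \<open>Cosets and maximal rank\<close>

definition mult_injective :: "nat \<Rightarrow> 'k::field poly3 \<Rightarrow> nat \<Rightarrow> bool" where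
  "mult_injective d l m \<longleftrightarrow> (\<forall>f\<in>forms m. l * f \<in> power_ideal d \<longrightarrow> f \<in> power_ideal d)"

definition mult_surjective :: "nat \<Rightarrow> 'k::field poly3 \<Rightarrow> nat \<Rightarrow> bool" where
  "mult_surjective d l m \<longleftrightarrow> (\<forall>g\<in>forms (Suc m). \<exists>f\<in>forms m. l * f - g \<in> power_ideal d)"

lemma coset_eq_iff:
  fixes f g :: "'k::field poly3"
  shows "power_ideal d +>\<^bsub>poly_ring\<^esub> f = power_ideal d +>\<^bsub>poly_ring\<^esub> g \<longleftrightarrow> f - g \<in> power_ideal d"
proof -
  interpret R: cring "poly_ring :: 'k poly3 ring"
    by (rule cring_from_type_algebra)
  have "\<ominus>\<^bsub>poly_ring\<^esub> g = - g"
    using R.minus_equality[of "- g" g] by (simp add: ring_of_type_algebra_def)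
  then have "f \<ominus>\<^bsub>poly_ring\<^esub> g = f - g"
    by (simp add: a_minus_def) (simp add: ring_of_type_algebra_def)
  then show ?thesis
    using R.quotient_eq_iff_same_a_r_cos[OF power_ideal_ideal, of f g d]
    by (simp add: ring_of_type_algebra_def)
qed

lemma quot_mult_coset:
  fixes l f :: "'k::field poly3"
  shows "quot_mult (power_ideal d) l (power_ideal d +>\<^bsub>poly_ring\<^esub> f) = power_ideal d +>\<^bsub>poly_ring\<^esub> (l * f)"
  using ideal.rcoset_mult_add[OF power_ideal_ideal[of d], of l f]
  by (simp add: quot_mult_def FactRing_def ring_of_type_algebra_def)

lemma quot_component_zero_iff:
  "quot_component (power_ideal d :: 'k::field poly3 set) m = {\<zero>\<^bsub>poly_ring Quot power_ideal d\<^esub>}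
    \<longleftrightarrow> forms m \<subseteq> (power_ideal d :: 'k poly3 set)"
proof -
  let ?I = "power_ideal d :: 'k poly3 set"
  interpret ideal ?I "poly_ring :: 'k poly3 ring"
    by (rule power_ideal_ideal)
  have "?I +>\<^bsub>poly_ring\<^esub> 0 = ?I"
    using a_coset_add_zero[OF a_subset] by (simp add: ring_of_type_algebra_def)
  then have "\<zero>\<^bsub>poly_ring Quot ?I\<^esub> = ?I +>\<^bsub>poly_ring\<^esub> 0"
    by (simp add: FactRing_def)
  moreover have "(0 :: 'k poly3) \<in> forms m"
    by simp
  then have "quot_component ?I m = {?I +>\<^bsub>poly_ring\<^esub> 0}
      \<longleftrightarrow> (\<forall>f\<in>forms m. ?I +>\<^bsub>poly_ring\<^esub> f = ?I +>\<^bsub>poly_ring\<^esub> 0)"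
    unfolding quot_component_def by blast
  ultimately show ?thesis
    by (simp add: coset_eq_iff subset_eq)
qed

lemma max_rank_at_iff:
  fixes l :: "'k::field poly3"
  assumes l: "l \<in> forms 1"
  shows "max_rank_at (power_ideal d) l m \<longleftrightarrow> mult_injective d l m \<or> mult_surjective d l m"
proof -
  let ?I = "power_ideal d :: 'k poly3 set"
  let ?C = "\<lambda>f. ?I +>\<^bsub>poly_ring\<^esub> f"
  have "inj_on (quot_mult ?I l) (quot_component ?I m) \<longleftrightarrow> mult_injective d l m"
  proof
    assume inj: "inj_on (quot_mult ?I l) (quot_component ?I m)"
    show "mult_injective d l m"
      unfolding mult_injective_def
    proof (intro ballI impI)
      fix f assume f: "f \<in> forms m" "l * f \<in> ?I"
      then have "quot_mult ?I l (?C f) = quot_mult ?I l (?C 0)"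
        by (simp add: quot_mult_coset coset_eq_iff)
      then have "?C f = ?C 0"
        by (rule inj_onD[OF inj]) (use f in \<open>auto simp: quot_component_def\<close>)
      then show "f \<in> ?I"
        by (simp add: coset_eq_iff)
    qed
  next
    assume "mult_injective d l m"
    then show "inj_on (quot_mult ?I l) (quot_component ?I m)"
      by (auto simp: inj_on_def quot_component_def quot_mult_coset coset_eq_iff mult_injective_def
          forms_diff simp flip: right_diff_distrib)
  qed
  moreover have "quot_mult ?I l ` quot_component ?I m = quot_component ?I (Suc m) \<longleftrightarrow> mult_surjective d l m"
  proof -
    have image: "quot_mult ?I l ` quot_component ?I m = (\<lambda>f. ?C (l * f)) ` forms m"
      by (simp add: quot_component_def image_image quot_mult_coset)
    have "l * f \<in> forms (Suc m)" if "f \<in> forms m" for f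
      using forms_mult[OF l that] by simp
    then have "quot_mult ?I l ` quot_component ?I m \<subseteq> quot_component ?I (Suc m)"
      unfolding image unfolding quot_component_def by blast
    then have "quot_mult ?I l ` quot_component ?I m = quot_component ?I (Suc m)
        \<longleftrightarrow> quot_component ?I (Suc m) \<subseteq> (\<lambda>f. ?C (l * f)) ` forms m"
      unfolding image by blast
    also have "\<dots> \<longleftrightarrow> (\<forall>g\<in>forms (Suc m). \<exists>f\<in>forms m. ?C g = ?C (l * f))"
      by (simp only: quot_component_def image_subset_iff image_iff)
    also have "\<dots> \<longleftrightarrow> (\<forall>g\<in>forms (Suc m). \<exists>f\<in>forms m. ?C (l * f) = ?C g)"
      by (simp only: eq_commute)
    finally show ?thesis
      by (simp add: mult_surjective_def coset_eq_iff)
  qed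
  ultimately show ?thesis
    by (simp add: max_rank_at_def)
qed

section \<open>Gorenstein duality\<close>

definition socle_monomial :: "nat \<Rightarrow> monomial" where
  "socle_monomial d = Poly_Mapping.single VX (d - 1) + Poly_Mapping.single VY (d - 1) + Poly_Mapping.single VZ (d - 1)"

lemma expo_socle_monomial: "expo (socle_monomial d) i = d - 1"
  by (cases i) (simp_all add: socle_monomial_def lookup_add lookup_single)

lemma mdeg_socle_monomial: "mdeg (socle_monomial d) = 3 * (d - 1)"
  by (simp add: mdeg_eq expo_socle_monomial)

lemma socle_coeff_power_ideal:
  assumes "d \<ge> 1" and "f \<in> power_ideal d"
  shows "coeff_at f (socle_monomial d) = 0"
proof (rule ccontr)
  assume "coeff_at f (socle_monomial d) \<noteq> 0"
  then have "\<exists>i. d \<le> expo (socle_monomial d) i"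
    using assms by (auto simp: power_ideal_iff in_keys_iff)
  then show False
    using assms by (simp add: expo_socle_monomial)
qed

text \<open>
  A form outside the ideal has a monomial with all exponents below \<open>d\<close>.  Multiplying by the complement
  of this monomial in \<open>(XYZ)\<^bsup>d-1\<^esup>\<close> moves its coefficient to the socle, and no other monomial goes there.
\<close>

lemma pairing_nondegenerate:
  fixes f :: "'k::field poly3"
  assumes "d \<ge> 1" and "f \<in> forms k" and "f \<notin> power_ideal d"
  obtains \<beta> where "mdeg \<beta> + k = 3 * (d - 1)"
    and "coeff_at (f * cmon \<beta> 1) (socle_monomial d) \<noteq> 0"
proof -
  obtain \<alpha> where \<alpha>: "\<alpha> \<in> Poly_Mapping.keys f" "\<And>i. expo \<alpha> i < d"
    using assms by (auto simp: power_ideal_iff not_le)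
  define \<beta> where "\<beta> = socle_monomial d - \<alpha>"
  have sum: "\<alpha> + \<beta> = socle_monomial d"
  proof (rule poly_mapping_eqI)
    fix i
    show "expo (\<alpha> + \<beta>) i = expo (socle_monomial d) i"
      using \<alpha>(2)[of i] by (simp add: \<beta>_def lookup_add lookup_minus expo_socle_monomial)
  qed
  have "mdeg \<beta> + k = 3 * (d - 1)"
    using forms_key_mdeg[OF assms(2) \<alpha>(1)] arg_cong[OF sum, of mdeg]
    by (simp add: mdeg_add mdeg_socle_monomial)
  moreover have "coeff_at (f * cmon \<beta> 1) (socle_monomial d) \<noteq> 0"
    using \<alpha>(1) coeff_mult_cmon[of f \<beta> 1 \<alpha>] by (simp add: sum in_keys_iff)
  ultimately show thesis
    by (rule that)
qed

lemma form_in_power_ideal_of_degree: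
  assumes "d \<ge> 1" and "f \<in> forms k" and "k > 3 * (d - 1)"
  shows "f \<in> power_ideal d"
  using assms pairing_nondegenerate[of d f k] by (metis not_add_less2)

lemma socle_term_notin_power_ideal:
  assumes "d \<ge> 1"
  shows "cmon (socle_monomial d) (1 :: 'k::field) \<notin> power_ideal d"
  using socle_coeff_power_ideal[OF assms] by (metis lookup_single_eq zero_neq_one)

lemma monomial_split:
  assumes "j \<le> mdeg \<beta>"
  obtains \<beta>1 \<beta>2 where "\<beta> = \<beta>1 + \<beta>2" and "mdeg \<beta>1 = j"
proof -
  have "\<exists>\<beta>1 \<beta>2. \<beta> = \<beta>1 + \<beta>2 \<and> mdeg \<beta>1 = j"
    using assms
  proof (induction j)
    case 0
    then show ?case
      by (intro exI[of _ 0] exI[of _ \<beta>]) simp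
  next
    case (Suc j)
    then obtain \<beta>1 \<beta>2 where *: "\<beta> = \<beta>1 + \<beta>2" "mdeg \<beta>1 = j"
      by auto
    then have "mdeg \<beta>2 > 0"
      using Suc.prems by (simp add: mdeg_add)
    then obtain i where i: "expo \<beta>2 i \<ge> 1"
      unfolding mdeg_eq by (metis One_nat_def Suc_leI add_gr_0)
    define \<beta>3 where "\<beta>3 = \<beta>2 - Poly_Mapping.single i 1"
    have "\<beta>2 = Poly_Mapping.single i 1 + \<beta>3"
      by (rule poly_mapping_eqI)
        (use i in \<open>auto simp: \<beta>3_def lookup_add lookup_minus lookup_single when_def\<close>)
    then have "\<beta> = (\<beta>1 + Poly_Mapping.single i 1) + \<beta>3"
      using * by (simp add: add.assoc)
    moreover have "mdeg (\<beta>1 + Poly_Mapping.single i 1) = Suc j"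
      using * by (simp add: mdeg_add)
    ultimately show ?case
      by blast
  qed
  then show thesis
    using that by blast
qed

text \<open>
  A nonzero class annihilated by \<open>l\<close> has a monomial multiple that spans the socle.  A partial product on
  the way there, in degree \<open>m'\<close>, is again nonzero and annihilated by \<open>l\<close>.
\<close>

lemma mult_injective_mono:
  assumes "d \<ge> 1" and "m \<le> m'" and "m' \<le> 3 * (d - 1)" and inj: "mult_injective d l m'"
  shows "mult_injective d l m"
  unfolding mult_injective_def
proof (intro ballI impI, rule ccontr)
  fix f assume f: "f \<in> forms m" "l * f \<in> power_ideal d" "f \<notin> power_ideal d"
  obtain \<beta> where \<beta>: "mdeg \<beta> + m = 3 * (d - 1)"
      "coeff_at (f * cmon \<beta> 1) (socle_monomial d) \<noteq> 0"
    using pairing_nondegenerate[OF assms(1) f(1,3)] .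
  have "m' - m \<le> mdeg \<beta>"
    using \<beta>(1) assms(2,3) by simp
  then obtain \<beta>1 \<beta>2 where split: "\<beta> = \<beta>1 + \<beta>2" "mdeg \<beta>1 = m' - m"
    by (rule monomial_split)
  have "f * cmon \<beta>1 1 \<in> forms m'"
    using forms_mult[OF f(1) forms_cmon[OF split(2)]] assms(2) by simp
  moreover have "l * (f * cmon \<beta>1 1) \<in> power_ideal d"
    using power_ideal_mult_left[OF f(2)] by (simp add: mult.assoc)
  ultimately have "f * cmon \<beta>1 1 \<in> power_ideal d"
    using inj by (auto simp: mult_injective_def)
  then have "f * cmon \<beta>1 1 * cmon \<beta>2 1 \<in> power_ideal d"
    by (rule power_ideal_mult_left)
  then have "f * cmon \<beta> 1 \<in> power_ideal d"
    by (simp add: split(1) mult.assoc mult_single)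
  with \<beta>(2) show False
    using socle_coeff_power_ideal[OF assms(1)] by blast
qed

text \<open>
  If \<open>l * f\<close> vanishes in the quotient, then \<open>f\<close> is orthogonal to all multiples of \<open>l\<close>; surjectivity
  makes these everything of the complementary degree.
\<close>

lemma mult_injective_of_surjective:
  assumes "d \<ge> 1" and m: "m + m' + 1 = 3 * (d - 1)" and surj: "mult_surjective d l m"
  shows "mult_injective d l m'"
  unfolding mult_injective_def
proof (intro ballI impI, rule ccontr)
  fix f assume f: "f \<in> forms m'" "l * f \<in> power_ideal d" "f \<notin> power_ideal d"
  obtain \<beta> where \<beta>: "mdeg \<beta> + m' = 3 * (d - 1)"
      "coeff_at (f * cmon \<beta> 1) (socle_monomial d) \<noteq> 0"
    using pairing_nondegenerate[OF assms(1) f(1,3)] .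
  have "mdeg \<beta> = Suc m"
    using \<beta>(1) m by simp
  then obtain h where h: "l * h - cmon \<beta> 1 \<in> power_ideal d"
    using surj forms_cmon by (metis mult_surjective_def)
  have "f * cmon \<beta> 1 = (l * f) * h - f * (l * h - cmon \<beta> 1)"
    by (simp add: algebra_simps)
  also have "\<dots> \<in> power_ideal d"
    using power_ideal_diff[OF power_ideal_mult_left[OF f(2)] power_ideal_mult[OF h]] .
  finally show False
    using socle_coeff_power_ideal[OF assms(1)] \<beta>(2) by blast
qed

lemma vector_space_poly3: "vector_space (\<lambda>(c :: 'k::field) (p :: 'k poly3). cmon 0 c * p)"
proof
  show "cmon 0 a * (cmon 0 b * p) = cmon 0 (a * b) * p" for a b :: 'k and p :: "'k poly3"
    by (simp add: mult_single mult.assoc[symmetric])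
qed (simp_all add: algebra_simps single_add)

text \<open>
  A basis of the subspace \<open>W\<close> together with \<open>g\<close> is linearly independent, so a linear functional can be
  prescribed on it.
\<close>

lemma separating_functional:
  fixes W :: "'k::field poly3 set"
  assumes W0: "0 \<in> W" and Wadd: "\<And>f g. f \<in> W \<Longrightarrow> g \<in> W \<Longrightarrow> f + g \<in> W"
    and Wscale: "\<And>c f. f \<in> W \<Longrightarrow> cmon 0 c * f \<in> W" and g: "g \<notin> W"
  shows "\<exists>\<phi> :: 'k poly3 \<Rightarrow> 'k. (\<forall>f h. \<phi> (f + h) = \<phi> f + \<phi> h)
    \<and> (\<forall>c f. \<phi> (cmon 0 c * f) = c * \<phi> f) \<and> (\<forall>f\<in>W. \<phi> f = 0) \<and> \<phi> g = 1"
proof -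
  interpret V: vector_space "\<lambda>(c :: 'k) (p :: 'k poly3). cmon 0 c * p"
    by (rule vector_space_poly3)
  interpret K: vector_space "(*) :: 'k \<Rightarrow> 'k \<Rightarrow> 'k"
    by unfold_locales (simp_all add: algebra_simps)
  interpret VK: vector_space_pair "\<lambda>(c :: 'k) (p :: 'k poly3). cmon 0 c * p" "(*) :: 'k \<Rightarrow> 'k \<Rightarrow> 'k" ..
  obtain B where B: "B \<subseteq> W" "V.independent B" "W \<subseteq> V.span B"
    using V.maximal_independent_subset .
  have "V.subspace W"
    using W0 Wadd Wscale by (auto simp: V.subspace_def)
  then have "V.span B \<subseteq> W"
    using B(1) by (simp add: V.span_minimal)
  with g have "g \<notin> V.span B" "g \<notin> B"
    using B(1) by auto
  then have "V.independent (insert g B)"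
    using B(2) by (simp add: V.independent_insert)
  then obtain \<phi> where \<phi>: "Vector_Spaces.linear (\<lambda>(c :: 'k) (p :: 'k poly3). cmon 0 c * p) (*) \<phi>"
      "\<forall>b\<in>insert g B. \<phi> b = (if b = g then 1 else 0)"
    using VK.linear_independent_extend[of "insert g B" "\<lambda>b. if b = g then 1 else 0"] by auto
  interpret \<phi>: Vector_Spaces.linear "\<lambda>(c :: 'k) (p :: 'k poly3). cmon 0 c * p" "(*)" \<phi>
    by (rule \<phi>(1))
  have "\<phi> g = 1"
    using \<phi>(2) by simp
  moreover have "\<phi> f = 0" if "f \<in> W" for f
  proof (rule VK.linear_eq_0_on_span[OF \<phi>(1)])
    show "f \<in> V.span B" using that B(3) by blast
    show "\<phi> b = 0" if "b \<in> B" for b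
      using \<phi>(2) that \<open>g \<notin> B\<close> by auto
  qed
  ultimately show ?thesis
    using \<phi>.add \<phi>.scale by blast
qed

text \<open>
  If \<open>g\<close> is not a multiple of \<open>l\<close> modulo the ideal, some functional \<open>\<phi>\<close> vanishes on these multiples
  but not on \<open>g\<close>.  The pairing represents \<open>\<phi>\<close> by a form \<open>f\<close> of the complementary degree.  Then \<open>l * f\<close> is
  orthogonal to everything, hence zero in the quotient, although \<open>f\<close> is not.
\<close>

lemma mult_surjective_of_injective:
  fixes l :: "'k::field poly3"
  assumes "d \<ge> 1" and l: "l \<in> forms 1" and m: "m + m' + 1 = 3 * (d - 1)"
    and inj: "mult_injective d l m'"
  shows "mult_surjective d l m"
proof (rule ccontr)
  assume "\<not> mult_surjective d l m"
  then obtain g where g: "g \<in> forms (Suc m)" "\<And>f. f \<in> forms m \<Longrightarrow> l * f - g \<notin> power_ideal d"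
    by (auto simp: mult_surjective_def)
  define W where "W = {l * f + h | f h. f \<in> forms m \<and> h \<in> power_ideal d}"
  have W0: "0 \<in> W"
    unfolding W_def by (intro CollectI exI[of _ 0]) simp
  have W_add: "p + q \<in> W" if W: "p \<in> W" "q \<in> W" for p q
  proof -
    obtain f h f' h' where "p = l * f + h" "f \<in> forms m" "h \<in> power_ideal d"
        "q = l * f' + h'" "f' \<in> forms m" "h' \<in> power_ideal d"
      using W by (auto simp: W_def)
    then show ?thesis
      unfolding W_def
      by (intro CollectI exI[of _ "f + f'"] exI[of _ "h + h'"])
        (auto simp: algebra_simps forms_add power_ideal_add)
  qed
  have W_scale: "cmon 0 c * p \<in> W" if W: "p \<in> W" for p and c :: 'k
  proof -
    obtain f h where "p = l * f + h" "f \<in> forms m" "h \<in> power_ideal d"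
      using W by (auto simp: W_def)
    moreover from this have "cmon 0 c * f \<in> forms m"
      using forms_mult[OF forms_cmon[OF mdeg_zero, of c], of f m] by simp
    moreover have "cmon 0 c * (l * f + h) = l * (cmon 0 c * f) + cmon 0 c * h"
      by (simp only: distrib_left mult.left_commute)
    ultimately show ?thesis
      unfolding W_def using power_ideal_mult by blast
  qed
  have g_W: "g \<notin> W"
  proof
    assume "g \<in> W"
    then obtain f h where fh: "g = l * f + h" "f \<in> forms m" "h \<in> power_ideal d"
      by (auto simp: W_def)
    then have "l * f - g \<in> power_ideal d"
      using power_ideal_uminus[OF fh(3)] by simp
    with g(2) fh(2) show False
      by blast
  qed
  obtain \<phi> :: "'k poly3 \<Rightarrow> 'k"
    where \<phi>: "\<forall>f h. \<phi> (f + h) = \<phi> f + \<phi> h" "\<forall>c f. \<phi> (cmon 0 c * f) = c * \<phi> f"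
      "\<forall>f\<in>W. \<phi> f = 0" and one: "\<phi> g = 1"
    using separating_functional[OF W0 W_add W_scale g_W] by blast
  have add: "\<phi> (f + h) = \<phi> f + \<phi> h" and scale: "\<phi> (cmon 0 c * f) = c * \<phi> f"
    and W: "f \<in> W \<Longrightarrow> \<phi> f = 0" for f h c
    using \<phi> by auto
  have \<phi>_ideal: "\<phi> h = 0" if "h \<in> power_ideal d" for h
  proof (rule W)
    have "h = l * 0 + h"
      by simp
    then show "h \<in> W"
      unfolding W_def using that forms_zero by blast
  qed
  have \<phi>_term: "\<phi> (cmon \<alpha> c) = c * \<phi> (cmon \<alpha> 1)" for \<alpha> c
    using scale[of c "cmon \<alpha> 1"] by (simp add: mult_single)
  \<comment> \<open>Only monomials outside the ideal matter, and those have a complement in the socle monomial.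
    The form \<open>f\<close> carries the value of \<open>\<phi>\<close> at each of them as the coefficient of the complement.\<close>
  define S where "S = {\<alpha>. mdeg \<alpha> = Suc m \<and> (\<forall>i. expo \<alpha> i < d)}"
  define f where "f = (\<Sum>\<alpha>\<in>S. cmon (socle_monomial d - \<alpha>) (\<phi> (cmon \<alpha> 1)))"
  have S_sum: "(socle_monomial d - \<alpha>) + \<alpha> = socle_monomial d" if "\<alpha> \<in> S" for \<alpha>
  proof (rule poly_mapping_eqI)
    fix i
    show "expo (socle_monomial d - \<alpha> + \<alpha>) i = expo (socle_monomial d) i"
      using that by (auto simp: S_def lookup_add lookup_minus expo_socle_monomial less_Suc_eq_le
          dest!: spec[of _ i])
  qed
  have "finite S"
  proof (rule finite_imageD)
    show "finite ((\<lambda>\<alpha>. (expo \<alpha> VX, expo \<alpha> VY, expo \<alpha> VZ)) ` S)"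
      by (rule finite_subset[of _ "{..<d} \<times> {..<d} \<times> {..<d}"]) (auto simp: S_def)
    show "inj_on (\<lambda>\<alpha>. (expo \<alpha> VX, expo \<alpha> VY, expo \<alpha> VZ)) S"
      by (auto simp: inj_on_def intro: monomial_eqI)
  qed
  have "f \<in> forms m'"
  proof -
    have "mdeg (socle_monomial d - \<alpha>) = m'" if "\<alpha> \<in> S" for \<alpha>
    proof -
      have "mdeg \<alpha> = Suc m"
        using that by (simp add: S_def)
      then show ?thesis
        using arg_cong[OF S_sum[OF that], of mdeg] m
        by (simp add: mdeg_add mdeg_socle_monomial)
    qed
    then show ?thesis
      unfolding f_def using \<open>finite S\<close>
      by (induction S rule: infinite_finite_induct) (auto intro!: forms_add forms_cmon)
  qed
  have represents_term: "coeff_at (f * cmon \<gamma> c) (socle_monomial d) = \<phi> (cmon \<gamma> c)"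
    if "mdeg \<gamma> = Suc m" for \<gamma> c
  proof (cases "\<gamma> \<in> S")
    case True
    have "coeff_at (f * cmon \<gamma> c) (socle_monomial d)
        = coeff_at f (socle_monomial d - \<gamma>) * c"
      using coeff_mult_cmon[of f \<gamma> c "socle_monomial d - \<gamma>"] S_sum[OF True] by simp
    also have "coeff_at f (socle_monomial d - \<gamma>)
        = (\<Sum>\<alpha>\<in>S. \<phi> (cmon \<alpha> 1) when socle_monomial d - \<alpha> = socle_monomial d - \<gamma>)"
      by (simp add: f_def lookup_sum lookup_single)
    also have "\<dots> = (\<Sum>\<alpha>\<in>S. if \<alpha> = \<gamma> then \<phi> (cmon \<alpha> 1) else 0)"
    proof (rule sum.cong)
      fix \<alpha> assume "\<alpha> \<in> S"
      then have "socle_monomial d - \<alpha> = socle_monomial d - \<gamma> \<longleftrightarrow> \<alpha> = \<gamma>"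
        using S_sum True by (metis add_left_cancel)
      then show "(\<phi> (cmon \<alpha> 1) when socle_monomial d - \<alpha> = socle_monomial d - \<gamma>)
          = (if \<alpha> = \<gamma> then \<phi> (cmon \<alpha> 1) else 0)"
        by (simp add: when_def)
    qed simp
    also have "\<dots> = \<phi> (cmon \<gamma> 1)"
      using True \<open>finite S\<close> by simp
    finally show ?thesis
      using \<phi>_term[of \<gamma> c] by (simp add: mult.commute)
  next
    case False
    then have "cmon \<gamma> c \<in> power_ideal d"
      using that by (auto simp: S_def power_ideal_iff not_less)
    then show ?thesis
      using \<phi>_ideal power_ideal_mult socle_coeff_power_ideal[OF assms(1)] by metis
  qed
  have represents: "coeff_at (f * p) (socle_monomial d) = \<phi> p" if "p \<in> forms (Suc m)" for p
  proof (rule poly3_terms_induct[where p = p])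
    show "coeff_at (f * 0) (socle_monomial d) = \<phi> 0"
      using \<phi>_ideal[of 0] by simp
    show "coeff_at (f * cmon \<alpha> c) (socle_monomial d) = \<phi> (cmon \<alpha> c)"
      if "\<alpha> \<in> Poly_Mapping.keys p" for \<alpha> c
      using represents_term forms_key_mdeg \<open>p \<in> forms (Suc m)\<close> that by blast
  qed (simp add: add lookup_add distrib_left)
  have "l * f \<in> power_ideal d"
  proof (rule ccontr)
    assume "l * f \<notin> power_ideal d"
    moreover have "l * f \<in> forms (1 + m')"
      using l \<open>f \<in> forms m'\<close> by (rule forms_mult)
    ultimately obtain \<beta> where \<beta>: "mdeg \<beta> + (1 + m') = 3 * (d - 1)"
        "coeff_at (l * f * cmon \<beta> 1) (socle_monomial d) \<noteq> 0"
      using pairing_nondegenerate[OF assms(1)] by blast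
    have "mdeg \<beta> = m"
      using \<beta>(1) m by simp
    then have \<beta>_form: "cmon \<beta> (1 :: 'k) \<in> forms m"
      by (rule forms_cmon)
    then have "l * cmon \<beta> 1 \<in> forms (Suc m)"
      using forms_mult[OF l] by force
    then have "coeff_at (f * (l * cmon \<beta> 1)) (socle_monomial d) = \<phi> (l * cmon \<beta> 1)"
      by (rule represents)
    also have "\<dots> = 0"
    proof (rule W)
      have "l * cmon \<beta> 1 = l * cmon \<beta> 1 + 0"
        by simp
      then show "l * cmon \<beta> 1 \<in> W"
        unfolding W_def using \<beta>_form power_ideal_zero by blast
    qed
    finally show False
      using \<beta>(2) by (simp add: mult_ac)
  qed
  with inj \<open>f \<in> forms m'\<close> have "f \<in> power_ideal d"
    by (auto simp: mult_injective_def)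
  then have "coeff_at (f * g) (socle_monomial d) = 0"
    by (intro socle_coeff_power_ideal assms(1) power_ideal_mult_left)
  with represents[OF g(1)] one show False
    by simp
qed

text \<open>
  For \<open>\<mu> = (3 * d - 4) div 2\<close>, the degrees \<open>m \<le> \<mu>\<close> are covered by injectivity at \<open>\<mu>\<close>, and the degrees
  \<open>m > \<mu>\<close> by duality, since then \<open>3 * d - 4 - m \<le> \<mu>\<close>.  Conversely, surjectivity at \<open>\<mu>\<close> is dual to
  injectivity at \<open>3 * d - 4 - \<mu> \<ge> \<mu>\<close>, so maximal rank at \<open>\<mu>\<close> means injectivity there in either case.
\<close>

lemma max_rank_all_iff:
  fixes l :: "'k::field poly3"
  assumes "d \<ge> 2" and l: "l \<in> forms 1"
  shows "(\<forall>m<3 * (d - 1). max_rank_at (power_ideal d) l m)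
    \<longleftrightarrow> mult_injective d l ((3 * d - 4) div 2)"
proof
  define \<mu> where "\<mu> = (3 * d - 4) div 2"
  have \<mu>: "\<mu> < 3 * (d - 1)" "2 * \<mu> + 1 \<le> 3 * (d - 1)" "3 * (d - 1) \<le> 2 * \<mu> + 2"
    using assms(1) by (auto simp: \<mu>_def)
  have d: "d \<ge> 1"
    using assms(1) by simp
  show "mult_injective d l ((3 * d - 4) div 2)" if "\<forall>m<3 * (d - 1). max_rank_at (power_ideal d) l m"
    unfolding \<mu>_def[symmetric]
  proof (rule ccontr)
    assume ninj: "\<not> mult_injective d l \<mu>"
    then have "mult_surjective d l \<mu>"
      using that \<mu>(1) l by (auto simp: max_rank_at_iff)
    then have "mult_injective d l (3 * (d - 1) - 1 - \<mu>)"
      by (rule mult_injective_of_surjective[OF d, rotated]) (use \<mu> in simp)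
    then have "mult_injective d l \<mu>"
      by (rule mult_injective_mono[OF d, rotated 2]) (use \<mu> in simp_all)
    with ninj show False ..
  qed
  show "\<forall>m<3 * (d - 1). max_rank_at (power_ideal d) l m" if "mult_injective d l ((3 * d - 4) div 2)"
  proof (intro allI impI)
    fix m assume m: "m < 3 * (d - 1)"
    have inj: "mult_injective d l m'" if "m' \<le> \<mu>" for m'
      by (rule mult_injective_mono[OF d that])
        (use \<mu> \<open>mult_injective d l ((3 * d - 4) div 2)\<close> in \<open>simp_all add: \<mu>_def\<close>)
    show "max_rank_at (power_ideal d) l m"
    proof (cases "m \<le> \<mu>")
      case True
      then show ?thesis
        using inj l by (simp add: max_rank_at_iff)
    next
      case False
      then have "mult_injective d l (3 * (d - 1) - 1 - m)"
        using \<mu> by (intro inj) simp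
      then have "mult_surjective d l m"
        by (rule mult_surjective_of_injective[OF d l, rotated]) (use m in simp)
      then show ?thesis
        using l by (simp add: max_rank_at_iff)
    qed
  qed
qed

section \<open>Kernel elements from powers of a linear form\<close>

text \<open>
  The last power \<open>l ^ i * h\<close> that is outside the ideal is annihilated by \<open>l\<close>.  Choosing the last one avoids
  computing coefficients of powers of \<open>l\<close> to see that they are nonzero.
\<close>

lemma kernel_element_of_power:
  assumes "l \<in> forms 1" and "h \<in> forms k" and "h \<notin> power_ideal d"
    and "l ^ j * h \<in> power_ideal d"
  shows "\<exists>i<j. \<not> mult_injective d l (k + i)"
  using assms(4)
proof (induction j)
  case 0
  then show ?case using assms(3) by simp
next
  case (Suc j)
  show ?case
  proof (cases "l ^ j * h \<in> power_ideal d")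
    case True
    then show ?thesis
      using Suc.IH less_SucI by blast
  next
    case False
    have "l ^ j * h \<in> forms (k + j)"
      using forms_mult[OF forms_power[OF assms(1)] assms(2), of j] by (simp add: add.commute)
    moreover have "l * (l ^ j * h) \<in> power_ideal d"
      using Suc.prems by (simp add: mult.assoc)
    ultimately show ?thesis
      using False by (auto simp: mult_injective_def)
  qed
qed

lemma char2_double:
  assumes "(1 :: 'a::comm_ring_1) + 1 = 0"
  shows "(x :: 'a) + x = 0"
  using assms by (metis distrib_left mult.right_neutral mult_zero_right)

lemma char2_add_power:
  fixes x y :: "'a::comm_ring_1"
  assumes "(1 :: 'a) + 1 = 0"
  shows "(x + y) ^ (2 ^ n) = x ^ (2 ^ n) + y ^ (2 ^ n)"
proof (induction n)
  case (Suc n)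
  have "(x + y) ^ (2 ^ Suc n) = ((x + y) ^ (2 ^ n)) ^ 2"
    by (simp only: power_Suc2 power_mult)
  also have "\<dots> = (x ^ (2 ^ n)) ^ 2 + (y ^ (2 ^ n)) ^ 2 + (x ^ (2 ^ n) * y ^ (2 ^ n) + x ^ (2 ^ n) * y ^ (2 ^ n))"
    by (simp add: Suc power2_eq_square algebra_simps)
  also have "\<dots> = x ^ (2 ^ Suc n) + y ^ (2 ^ Suc n)"
    by (simp only: char2_double[OF assms] power_Suc2 power_mult add_0_right)
  finally show ?case .
qed simp

lemma char2_poly3: "(1 :: 'k::field) + 1 = 0 \<Longrightarrow> (1 :: 'k poly3) + 1 = 0"
  using single_add[of "0 :: monomial" "1 :: 'k" 1] by simp

lemma single_power:
  "cmon (Poly_Mapping.single i 1) (c :: 'k::field) ^ n = cmon (Poly_Mapping.single i n) (c ^ n)"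
  by (induction n) (simp_all add: mult_single flip: single_add)

lemma linear_form_power:
  fixes l :: "'k::field poly3"
  assumes char2: "(1 :: 'k) + 1 = 0" and l: "l \<in> forms 1"
  shows "l ^ (2 ^ n) = cmon (Poly_Mapping.single VX (2 ^ n)) (linear_coeffs l VX ^ 2 ^ n)
    + cmon (Poly_Mapping.single VY (2 ^ n)) (linear_coeffs l VY ^ 2 ^ n)
    + cmon (Poly_Mapping.single VZ (2 ^ n)) (linear_coeffs l VZ ^ 2 ^ n)"
  by (subst linear_form_eq[OF l]) (simp only: char2_add_power[OF char2_poly3[OF char2]] single_power)

lemma term_in_power_ideal: "d \<le> expo \<alpha> i \<Longrightarrow> cmon \<alpha> c \<in> power_ideal d"
  by (auto simp: power_ideal_iff)

lemma linear_form_power_mult_in_power_ideal: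
  fixes l :: "'k::field poly3"
  assumes "(1 :: 'k) + 1 = 0" and "l \<in> forms 1" and "\<And>i. d \<le> 2 ^ n + expo \<alpha> i"
  shows "l ^ (2 ^ n) * cmon \<alpha> 1 \<in> power_ideal d"
proof -
  have "cmon (Poly_Mapping.single i (2 ^ n)) x * cmon \<alpha> 1 \<in> power_ideal d" for i and x :: 'k
    unfolding mult_single by (rule term_in_power_ideal[of _ _ i]) (use assms(3) in \<open>simp add: lookup_add\<close>)
  then show ?thesis
    unfolding linear_form_power[OF assms(1,2)] distrib_right by (intro power_ideal_add)
qed

text \<open>
  With \<open>q = 2 ^ n\<close> and \<open>r = d - q\<close>, the relation \<open>l ^ q * (XYZ)\<^sup>r \<in> I\<close> gives a kernel element of degree at
  most \<open>q - 1 + 3 * r\<close>, and \<open>l ^ (2 * q) \<in> I\<close> gives one of degree at most \<open>2 * q - 1\<close>.  The two inequalities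
  say that neither bound is at most \<open>(3 * d - 4) div 2\<close>.
\<close>

lemma injective_imp_near_power:
  fixes l :: "'k::field poly3"
  assumes char2: "(1 :: 'k) + 1 = 0" and l: "l \<in> forms 1" and "d \<ge> 2"
    and q: "2 ^ n \<le> d" "d \<le> 2 ^ Suc n"
    and inj: "mult_injective d l ((3 * d - 4) div 2)"
  shows "4 * 2 ^ n \<le> 3 * d + 1" and "3 * d \<le> 4 * 2 ^ n + 1"
proof -
  have "(3 * d - 4) div 2 \<le> 3 * (d - 1)"
    using \<open>d \<ge> 2\<close> by linarith
  then have not_inj: False if "\<not> mult_injective d l m" "m \<le> (3 * d - 4) div 2" for m
    using mult_injective_mono[OF _ that(2) _ inj] that(1) \<open>d \<ge> 2\<close> by auto
  show "4 * 2 ^ n \<le> 3 * d + 1"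
  proof (rule ccontr)
    assume far: "\<not> 4 * 2 ^ n \<le> 3 * d + 1"
    define r where "r = d - 2 ^ n"
    define \<alpha> where "\<alpha> = Poly_Mapping.single VX r + Poly_Mapping.single VY r + Poly_Mapping.single VZ r"
    have expo: "expo \<alpha> i = r" for i
      by (cases i) (simp_all add: \<alpha>_def lookup_add lookup_single)
    have "cmon \<alpha> (1 :: 'k) \<in> forms (3 * r)"
      by (rule forms_cmon) (simp add: mdeg_eq expo)
    moreover have "cmon \<alpha> (1 :: 'k) \<notin> power_ideal d"
      using q(1) \<open>d \<ge> 2\<close> by (simp add: power_ideal_iff expo r_def not_le)
    moreover have "l ^ (2 ^ n) * cmon \<alpha> 1 \<in> power_ideal d"
      by (rule linear_form_power_mult_in_power_ideal[OF char2 l]) (simp add: expo r_def)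
    ultimately obtain i where "i < 2 ^ n" "\<not> mult_injective d l (3 * r + i)"
      using kernel_element_of_power[OF l] by blast
    moreover from this have "3 * r + i \<le> (3 * d - 4) div 2"
      using far q unfolding r_def by simp
    ultimately show False
      using not_inj by blast
  qed
  show "3 * d \<le> 4 * 2 ^ n + 1"
  proof (rule ccontr)
    assume far: "\<not> 3 * d \<le> 4 * 2 ^ n + 1"
    have "l ^ (2 ^ Suc n) * cmon 0 1 \<in> power_ideal d"
      by (rule linear_form_power_mult_in_power_ideal[OF char2 l]) (use q in simp)
    moreover have "cmon 0 (1 :: 'k) \<notin> power_ideal d"
      using \<open>d \<ge> 2\<close> by (simp add: power_ideal_iff del: single_one)
    moreover have "cmon 0 (1 :: 'k) \<in> forms 0"
      by (rule forms_cmon) simp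
    ultimately obtain i where "i < 2 ^ Suc n" "\<not> mult_injective d l (0 + i)"
      using kernel_element_of_power[OF l] by blast
    moreover from this have "0 + i \<le> (3 * d - 4) div 2"
      using far by simp
    ultimately show False
      using not_inj by blast
  qed
qed

section \<open>Syzygies of the three powers in one variable\<close>

lemma root_power_dvd_mult_imp_zero:
  fixes p g :: "'k::field poly"
  assumes "poly p a \<noteq> 0" and "[:- a, 1:] ^ m dvd p * g" and "degree g < m"
  shows "g = 0"
proof (rule ccontr)
  assume "g \<noteq> 0"
  moreover have "p \<noteq> 0"
    using assms(1) by auto
  ultimately have "p * g \<noteq> 0"
    by simp
  then have "m \<le> order a (p * g)"
    using assms(2) by (simp add: order_divides)
  also have "\<dots> = order a g"
    using \<open>p * g \<noteq> 0\<close> assms(1) by (simp add: order_mult order_0I)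
  also have "\<dots> \<le> degree g"
    using \<open>g \<noteq> 0\<close> by (rule order_degree)
  finally show False
    using assms(3) by simp
qed

lemma char2_solve:
  fixes x y :: "'a::comm_ring_1"
  assumes "(1 :: 'a) + 1 = 0" and "x + y = 0"
  shows "x = y"
  using assms(2) char2_double[OF assms(1), of y] by (metis add_right_cancel)

text \<open>
  The syzygies \<open>S\<^sub>1 = (x ^ (q - r), 1, z ^ (q - r))\<close> and \<open>S\<^sub>2 = (z ^ r, x ^ r * z ^ r, x ^ r)\<close>, where
  \<open>z = x + 1\<close>, come from \<open>x ^ (2 * q) + 1 + z ^ (2 * q) = 0\<close> and \<open>x ^ q + 1 + z ^ q = 0\<close>.  The cross product
  of \<open>(u, v, w)\<close> with either of them is orthogonal to both factors and hence proportional to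
  \<open>(x ^ d, 1, z ^ d)\<close>; its degree is too low for that, so it vanishes.  A vector proportional to both \<open>S\<^sub>1\<close>
  and \<open>S\<^sub>2\<close> is zero.  The proof uses the last component of each cross product.
\<close>

lemma no_low_degree_syzygy:
  fixes u v w :: "'k::field poly"
  assumes char2: "(1 :: 'k) + 1 = 0"
    and deg: "degree u \<le> n" "degree v \<le> n" "degree w \<le> n"
    and syz: "u * [:0, 1:] ^ d + v + w * [:1, 1:] ^ d = 0"
    and q: "q = 2 ^ k" "d = q + r" "n < 2 * r" "n + r < q"
  shows "u = 0 \<and> v = 0 \<and> w = 0"
proof -
  define x z :: "'k poly" where "x = [:0, 1:]" and "z = [:1, 1:]"
  have char2': "(1 :: 'k poly) + 1 = 0"
    using char2 by (simp add: one_pCons)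
  have zx: "z = x + 1"
    by (simp add: x_def z_def one_pCons)
  have zq: "z ^ q = x ^ q + 1"
    unfolding zx q(1) by (simp add: char2_add_power[OF char2'])
  have z_root: "z = [:- 1, 1:]"
    using char2_solve[OF char2, of "1" "1"] char2 by (simp add: z_def eq_neg_iff_add_eq_0)
  have x_root: "poly (x ^ m) 1 \<noteq> 0" for m
    by (simp add: x_def)
  have deg_mult: "degree (p * x ^ m) \<le> n + m" if "degree p \<le> n" for p m
    using degree_mult_le[of p "x ^ m"] degree_power_le[of x m] that by (simp add: x_def)
  have v_eq: "v = u * x ^ d + w * z ^ d"
    using syz char2_solve[OF char2', of v "u * x ^ d + w * z ^ d"] by (simp add: x_def z_def add_ac)
  have double: "p + p = 0" for p :: "'k poly"
    by (rule char2_double[OF char2'])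
  \<comment> \<open>The last component of the cross product with \<open>S\<^sub>1\<close> is divisible by \<open>z ^ d\<close>.\<close>
  have q2: "2 * q = d + (q - r)"
    using q by simp
  have "u + v * x ^ (q - r) = 0"
  proof (rule root_power_dvd_mult_imp_zero[OF x_root[of d]])
    have "x ^ d * (u + v * x ^ (q - r)) = u * x ^ d + v * x ^ (2 * q)"
      unfolding q2 power_add by (simp add: algebra_simps)
    also have "x ^ (2 * q) = z ^ (2 * q) + 1"
    proof -
      have "z ^ (2 * q) = x ^ (2 * q) + 1"
        using char2_add_power[OF char2', of x 1 "Suc k"] by (simp add: zx q(1))
      then show ?thesis
        using double[of 1] by (simp add: add.assoc)
    qed
    also have "u * x ^ d + v * (z ^ (2 * q) + 1) = v * z ^ (2 * q) + (u * x ^ d + v)"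
      by (simp add: algebra_simps)
    also have "u * x ^ d + v = w * z ^ d"
      using double[of "u * x ^ d"] by (simp add: v_eq flip: add.assoc)
    also have "z ^ (2 * q) = z ^ d * z ^ (q - r)"
      unfolding q2 by (rule power_add)
    finally have "x ^ d * (u + v * x ^ (q - r)) = z ^ d * (v * z ^ (q - r) + w)"
      by (simp add: algebra_simps)
    then show "[:- 1, 1:] ^ d dvd x ^ d * (u + v * x ^ (q - r))"
      by (simp flip: z_root)
    show "degree (u + v * x ^ (q - r)) < d"
    proof (rule le_less_trans)
      show "degree (u + v * x ^ (q - r)) \<le> n + (q - r)"
        by (intro degree_add_le deg_mult deg(2) trans_le_add1 deg(1))
      show "n + (q - r) < d"
        using q by simp
    qed
  qed
  \<comment> \<open>The last component of the cross product with \<open>S\<^sub>2\<close> is \<open>z ^ r\<close> times this one.  It is divisible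
    by \<open>z ^ d\<close>, which leaves the divisor \<open>z ^ q\<close>.\<close>
  moreover have "u * x ^ r + v = 0"
  proof (rule root_power_dvd_mult_imp_zero[OF x_root[of q]])
    have "x ^ q * (u * x ^ r + v) = u * x ^ d + v * x ^ q"
      using q by (simp add: algebra_simps power_add)
    also have "\<dots> = w * z ^ d + v * (x ^ q + 1)"
      using double[of "u * x ^ d"] double[of "w * z ^ d"]  by (simp add: v_eq algebra_simps)
    also have "\<dots> = z ^ q * (w * z ^ r + v)"
      unfolding zq[symmetric] q(2) power_add by (simp add: algebra_simps)
    finally show "[:- 1, 1:] ^ q dvd x ^ q * (u * x ^ r + v)"
      by (simp flip: z_root)
    show "degree (u * x ^ r + v) < q"
    proof (rule le_less_trans)
      show "degree (u * x ^ r + v) \<le> n + r"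
        by (intro degree_add_le deg_mult deg(1) trans_le_add1 deg(2))
    qed (rule q(4))
  qed
  ultimately have uv: "u = v * x ^ (q - r)" "v = u * x ^ r"
    using char2_solve[OF char2'] by (metis, metis add.commute)
  then have "u = u * x ^ r * x ^ (q - r)"
    by simp
  also have "\<dots> = u * x ^ q"
    using q by (simp add: mult.assoc flip: power_add)
  finally have "u * x ^ q = u" ..
  then have "u * z ^ q = 0"
    by (simp only: zq distrib_left mult_1_right double)
  then have "u = 0"
    by (simp add: z_def)
  moreover from this have "v = 0"
    using uv(2) by simp
  moreover from calculation have "w = 0"
    using v_eq by (simp add: z_def)
  ultimately show ?thesis
    by simp
qed

section \<open>Restriction to the line where a linear form vanishes\<close>

definition subst_monomial :: "(var \<Rightarrow> 'k poly) \<Rightarrow> monomial \<Rightarrow> 'k::field poly" where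
  "subst_monomial v \<alpha> = v VX ^ expo \<alpha> VX * v VY ^ expo \<alpha> VY * v VZ ^ expo \<alpha> VZ"

definition subst_poly :: "(var \<Rightarrow> 'k poly) \<Rightarrow> 'k::field poly3 \<Rightarrow> 'k poly" where
  "subst_poly v f = (\<Sum>\<alpha>\<in>Poly_Mapping.keys f. smult (coeff_at f \<alpha>) (subst_monomial v \<alpha>))"

lemma subst_poly_superset:
  assumes "finite A" and "Poly_Mapping.keys f \<subseteq> A"
  shows "subst_poly v f = (\<Sum>\<alpha>\<in>A. smult (coeff_at f \<alpha>) (subst_monomial v \<alpha>))"
  unfolding subst_poly_def
  by (rule sum.mono_neutral_left) (use assms in \<open>auto simp: in_keys_iff\<close>)

lemma subst_poly_zero [simp]: "subst_poly v 0 = 0"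
  by (simp add: subst_poly_def)

lemma subst_poly_add: "subst_poly v (f + g) = subst_poly v f + subst_poly v g"
proof -
  let ?A = "Poly_Mapping.keys f \<union> Poly_Mapping.keys g"
  have "subst_poly v (f + g) = (\<Sum>\<alpha>\<in>?A. smult (coeff_at (f + g) \<alpha>) (subst_monomial v \<alpha>))"
    by (rule subst_poly_superset) (simp_all add: keys_add)
  then show ?thesis
    by (simp add: subst_poly_superset[of ?A f] subst_poly_superset[of ?A g] lookup_add smult_add_left sum.distrib)
qed

lemma subst_poly_cmon: "subst_poly v (cmon \<alpha> c) = smult c (subst_monomial v \<alpha>)"
  by (cases "c = 0") (simp_all add: subst_poly_def)

lemma subst_monomial_add: "subst_monomial v (\<alpha> + \<beta>) = subst_monomial v \<alpha> * subst_monomial v \<beta>"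
  by (simp add: subst_monomial_def lookup_add power_add mult_ac)

lemma subst_poly_mult: "subst_poly v (f * g) = subst_poly v f * subst_poly v g"
proof (rule poly3_terms_induct[where p = f])
  fix \<alpha> and c :: 'a
  show "subst_poly v (cmon \<alpha> c * g) = subst_poly v (cmon \<alpha> c) * subst_poly v g"
  proof (rule poly3_terms_induct[where p = g])
    show "subst_poly v (cmon \<alpha> c * cmon \<beta> b) = subst_poly v (cmon \<alpha> c) * subst_poly v (cmon \<beta> b)" for \<beta> b
      by (simp add: mult_single subst_poly_cmon subst_monomial_add mult.commute[of b c])
  qed (simp_all add: distrib_left subst_poly_add)
qed (simp_all add: distrib_right subst_poly_add)

lemma subst_poly_Var_power: "subst_poly v (Var i ^ n) = v i ^ n"
  by (cases i) (simp_all add: Var_power subst_poly_cmon subst_monomial_def lookup_single)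

lemma degree_subst_poly_le:
  assumes "\<And>i. degree (v i) \<le> 1" and "f \<in> forms n"
  shows "degree (subst_poly v f) \<le> n"
proof (rule poly3_terms_induct[where p = f])
  fix \<alpha> c
  assume "\<alpha> \<in> Poly_Mapping.keys f"
  then have "mdeg \<alpha> = n"
    using assms(2) by (simp add: forms_key_mdeg)
  have pow: "degree (v i ^ m) \<le> m" for i m
    using order_trans[OF degree_power_le[of "v i" m] mult_le_mono1[OF assms(1)[of i], of m]] by simp
  have "degree (subst_monomial v \<alpha>) \<le> expo \<alpha> VX + expo \<alpha> VY + expo \<alpha> VZ"
    unfolding subst_monomial_def by (intro order_trans[OF degree_mult_le] add_mono pow)
  then show "degree (subst_poly v (cmon \<alpha> c)) \<le> n"
    using \<open>mdeg \<alpha> = n\<close> degree_smult_le[of c "subst_monomial v \<alpha>"]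
    by (simp add: subst_poly_cmon mdeg_eq)
qed (auto simp: subst_poly_add intro: degree_add_le)

text \<open>
  A parametrization, in the chart where the second scaled coordinate is \<open>1\<close>, of the projective line
  \<open>l = 0\<close> for \<open>l = a X + b Y + c Z\<close>: the scaled coordinates \<open>a X\<close>, \<open>b Y\<close>, \<open>c Z\<close> become \<open>x\<close>, \<open>1\<close>, \<open>x + 1\<close>, and their sum is
  zero in characteristic \<open>2\<close>.
\<close>

definition line_param :: "'k::field poly3 \<Rightarrow> var \<Rightarrow> 'k poly" where
  "line_param l i = smult (inverse (linear_coeffs l i)) (case i of VX \<Rightarrow> [:0, 1:] | VY \<Rightarrow> 1 | VZ \<Rightarrow> [:1, 1:])"

lemma degree_line_param: "degree (line_param l i) \<le> 1"
  by (cases i) (simp_all add: line_param_def)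

lemma subst_poly_linear_form:
  fixes l :: "'k::field poly3"
  assumes "(1 :: 'k) + 1 = 0" and "l \<in> forms 1" and "\<And>i. linear_coeffs l i \<noteq> 0"
  shows "subst_poly (line_param l) l = 0"
proof -
  have "subst_poly (line_param l) l = smult (linear_coeffs l VX) (line_param l VX)
      + smult (linear_coeffs l VY) (line_param l VY) + smult (linear_coeffs l VZ) (line_param l VZ)"
    by (subst (2) linear_form_eq[OF assms(2)])
      (simp add: subst_poly_add subst_poly_cmon subst_monomial_def lookup_single)
  also have "\<dots> = [:2, 2:]"
    using assms(3) by (simp add: line_param_def one_pCons)
  also have "\<dots> = 0"
    using assms(1) by simp
  finally show ?thesis .
qed

text \<open>
  Modulo \<open>l = a X + b Y + c Z\<close> a factor \<open>Z\<close> can be replaced by \<open>- (a X + b Y) / c\<close>, which lowers the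
  exponent of \<open>Z\<close> by one in both resulting monomials.
\<close>

lemma eliminate_VZ_term:
  fixes l :: "'k::field poly3"
  assumes l: "l \<in> forms 1" and c: "linear_coeffs l VZ \<noteq> 0"
  shows "\<exists>g h. cmon \<alpha> x = l * g + h \<and> h \<in> forms (mdeg \<alpha>)
    \<and> (\<forall>\<beta>\<in>Poly_Mapping.keys h. expo \<beta> VZ = 0)"
proof (induction "expo \<alpha> VZ" arbitrary: \<alpha> x)
  case 0
  have "cmon \<alpha> x = l * 0 + cmon \<alpha> x"
    by simp
  moreover have "\<forall>\<beta>\<in>Poly_Mapping.keys (cmon \<alpha> x). expo \<beta> VZ = 0"
    using 0 by simp
  ultimately show ?case
    using forms_cmon[OF refl, of \<alpha> x] by blast
next
  case (Suc k)
  let ?e = "\<lambda>i. Poly_Mapping.single i (1 :: nat)"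
  let ?a = "linear_coeffs l"
  define \<alpha>' where "\<alpha>' = \<alpha> - ?e VZ"
  define y where "y = x / ?a VZ"
  have \<alpha>: "\<alpha> = \<alpha>' + ?e VZ"
    by (rule monomial_eqI) (use Suc.hyps(2) in \<open>simp_all add: \<alpha>'_def lookup_add lookup_minus lookup_single\<close>)
  have deg: "mdeg (\<alpha>' + ?e i) = mdeg \<alpha>" for i
    by (simp add: \<alpha> mdeg_add)
  have k: "k = expo (\<alpha>' + ?e VX) VZ" "k = expo (\<alpha>' + ?e VY) VZ"
    using Suc.hyps(2) by (simp_all add: \<alpha>'_def lookup_add lookup_minus lookup_single)
  obtain g1 h1 where 1: "cmon (\<alpha>' + ?e VX) (- y * ?a VX) = l * g1 + h1"
      "h1 \<in> forms (mdeg \<alpha>)" "\<forall>\<beta>\<in>Poly_Mapping.keys h1. expo \<beta> VZ = 0"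
    using Suc.hyps(1)[OF k(1)] deg by metis
  obtain g2 h2 where 2: "cmon (\<alpha>' + ?e VY) (- y * ?a VY) = l * g2 + h2"
      "h2 \<in> forms (mdeg \<alpha>)" "\<forall>\<beta>\<in>Poly_Mapping.keys h2. expo \<beta> VZ = 0"
    using Suc.hyps(1)[OF k(2)] deg by metis
  have "cmon \<alpha>' y * l = cmon (\<alpha>' + ?e VX) (y * ?a VX)
      + cmon (\<alpha>' + ?e VY) (y * ?a VY) + cmon \<alpha> (y * ?a VZ)"
    by (subst linear_form_eq[OF l]) (simp add: distrib_left mult_single \<alpha>)
  moreover have "y * ?a VZ = x"
    using c by (simp add: y_def)
  ultimately have "cmon \<alpha> x = l * cmon \<alpha>' y
      + cmon (\<alpha>' + ?e VX) (- y * ?a VX) + cmon (\<alpha>' + ?e VY) (- y * ?a VY)"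
    by (simp add: single_uminus mult.commute)
  also have "\<dots> = l * (cmon \<alpha>' y + g1 + g2) + (h1 + h2)"
    unfolding 1(1) 2(1) by (simp add: distrib_left)
  finally have "cmon \<alpha> x = l * (cmon \<alpha>' y + g1 + g2) + (h1 + h2)" .
  moreover have "h1 + h2 \<in> forms (mdeg \<alpha>)"
    using 1(2) 2(2) by (rule forms_add)
  moreover have "\<forall>\<beta>\<in>Poly_Mapping.keys (h1 + h2). expo \<beta> VZ = 0"
    using 1(3) 2(3) keys_add[of h1 h2] by blast
  ultimately show ?case
    by blast
qed

lemma eliminate_VZ:
  fixes l :: "'k::field poly3"
  assumes "l \<in> forms 1" and "linear_coeffs l VZ \<noteq> 0" and "f \<in> forms n"
  shows "\<exists>g h. f = l * g + h \<and> h \<in> forms n \<and> (\<forall>\<beta>\<in>Poly_Mapping.keys h. expo \<beta> VZ = 0)"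
proof (rule poly3_terms_induct[where p = f])
  show "\<exists>g h. 0 = l * g + h \<and> h \<in> forms n \<and> (\<forall>\<beta>\<in>Poly_Mapping.keys h. expo \<beta> VZ = 0)"
    by (intro exI[of _ 0]) simp
next
  fix f1 f2
  assume "\<exists>g h. f1 = l * g + h \<and> h \<in> forms n \<and> (\<forall>\<beta>\<in>Poly_Mapping.keys h. expo \<beta> VZ = 0)"
    and "\<exists>g h. f2 = l * g + h \<and> h \<in> forms n \<and> (\<forall>\<beta>\<in>Poly_Mapping.keys h. expo \<beta> VZ = 0)"
  then obtain g1 h1 g2 h2 where *:
    "f1 = l * g1 + h1" "h1 \<in> forms n" "\<forall>\<beta>\<in>Poly_Mapping.keys h1. expo \<beta> VZ = 0"
    "f2 = l * g2 + h2" "h2 \<in> forms n" "\<forall>\<beta>\<in>Poly_Mapping.keys h2. expo \<beta> VZ = 0"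
    by blast
  have "f1 + f2 = l * (g1 + g2) + (h1 + h2)"
    by (simp add: * distrib_left)
  moreover have "h1 + h2 \<in> forms n"
    using *(2,5) by (rule forms_add)
  moreover have "\<forall>\<beta>\<in>Poly_Mapping.keys (h1 + h2). expo \<beta> VZ = 0"
    using *(3,6) keys_add[of h1 h2] by blast
  ultimately show "\<exists>g h. f1 + f2 = l * g + h \<and> h \<in> forms n \<and> (\<forall>\<beta>\<in>Poly_Mapping.keys h. expo \<beta> VZ = 0)"
    by blast
next
  fix \<alpha> x
  assume "\<alpha> \<in> Poly_Mapping.keys f"
  then have "mdeg \<alpha> = n"
    using assms(3) by (simp add: forms_key_mdeg)
  then show "\<exists>g h. cmon \<alpha> x = l * g + h \<and> h \<in> forms n \<and> (\<forall>\<beta>\<in>Poly_Mapping.keys h. expo \<beta> VZ = 0)"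
    using eliminate_VZ_term[OF assms(1,2), of \<alpha> x] by simp
qed

text \<open>
  Two monomials in \<open>X\<close> and \<open>Y\<close> of the same degree are told apart by the exponent of \<open>X\<close>, which survives
  the substitution as the exponent of \<open>x\<close>.
\<close>

lemma binary_form_zero:
  fixes l :: "'k::field poly3"
  assumes coeffs: "\<And>i. linear_coeffs l i \<noteq> 0" and h: "h \<in> forms n"
    and VZ: "\<forall>\<beta>\<in>Poly_Mapping.keys h. expo \<beta> VZ = 0"
    and zero: "subst_poly (line_param l) h = 0"
  shows "h = 0"
proof (rule ccontr)
  assume "h \<noteq> 0"
  then obtain \<alpha> where \<alpha>: "\<alpha> \<in> Poly_Mapping.keys h"
    using keys_eq_empty by blast
  define s where "s \<beta> = inverse (linear_coeffs l VX) ^ expo \<beta> VX * inverse (linear_coeffs l VY) ^ expo \<beta> VY" for \<beta>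
  have monom: "subst_monomial (line_param l) \<beta> = monom (s \<beta>) (expo \<beta> VX)" if "\<beta> \<in> Poly_Mapping.keys h" for \<beta>
  proof -
    have "line_param l VX = monom (inverse (linear_coeffs l VX)) 1"
      "line_param l VY = monom (inverse (linear_coeffs l VY)) 0"
      by (simp_all add: line_param_def monom_altdef one_pCons)
    then show ?thesis
      using VZ that by (simp add: subst_monomial_def s_def monom_power mult_monom)
  qed
  have unique: "expo \<beta> VX = expo \<alpha> VX \<longleftrightarrow> \<beta> = \<alpha>" if "\<beta> \<in> Poly_Mapping.keys h" for \<beta>
  proof
    assume "expo \<beta> VX = expo \<alpha> VX"
    moreover have "mdeg \<beta> = n" "mdeg \<alpha> = n"
      using h that \<alpha> by (simp_all add: forms_key_mdeg)
    ultimately show "\<beta> = \<alpha>"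
      using VZ that \<alpha> by (intro monomial_eqI) (simp_all add: mdeg_eq)
  qed simp
  have "0 = coeff (subst_poly (line_param l) h) (expo \<alpha> VX)"
    by (simp add: zero)
  also have "\<dots> = (\<Sum>\<beta>\<in>Poly_Mapping.keys h. if \<beta> = \<alpha> then coeff_at h \<beta> * s \<beta> else 0)"
    unfolding subst_poly_def coeff_sum by (rule sum.cong) (auto simp: monom unique)
  also have "\<dots> = coeff_at h \<alpha> * s \<alpha>"
    using \<alpha> by simp
  finally show False
    using \<alpha> coeffs by (simp add: s_def in_keys_iff)
qed

lemma linear_form_dvd:
  fixes l :: "'k::field poly3"
  assumes char2: "(1 :: 'k) + 1 = 0" and l: "l \<in> forms 1" and coeffs: "\<And>i. linear_coeffs l i \<noteq> 0"
    and f: "f \<in> forms n" and zero: "subst_poly (line_param l) f = 0"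
  shows "l dvd f"
proof -
  obtain g h where gh: "f = l * g + h" "h \<in> forms n" "\<forall>\<beta>\<in>Poly_Mapping.keys h. expo \<beta> VZ = 0"
    using eliminate_VZ[OF l coeffs f] by blast
  have "subst_poly (line_param l) h = 0"
    using zero subst_poly_linear_form[OF char2 l coeffs] by (simp add: gh(1) subst_poly_add subst_poly_mult)
  then have "h = 0"
    by (rule binary_form_zero[OF coeffs gh(2,3)])
  then show ?thesis
    by (simp add: gh(1))
qed

section \<open>Injectivity in the middle degree\<close>

text \<open>
  For \<open>k < d\<close> the subtraction \<open>k - d\<close> truncates to \<open>0\<close>; in this case \<open>f\<close> is zero, and so are the
  cofactors.
\<close>

lemma power_ideal_form_decomposition:
  fixes f :: "'k::field poly3"
  assumes "f \<in> power_ideal d" and "f \<in> forms k"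
  shows "\<exists>u\<in>forms (k - d). \<exists>v\<in>forms (k - d). \<exists>w\<in>forms (k - d).
    f = u * Var VX ^ d + v * Var VY ^ d + w * Var VZ ^ d"
proof -
  define D where "D f \<longleftrightarrow> (\<exists>u\<in>forms (k - d). \<exists>v\<in>forms (k - d). \<exists>w\<in>forms (k - d).
    f = u * Var VX ^ d + v * Var VY ^ d + w * Var VZ ^ d)" for f :: "'k poly3"
  have "D f"
  proof (rule poly3_terms_induct[where p = f])
    show "D 0"
      unfolding D_def by (intro bexI[of _ 0]) simp_all
  next
    fix f g assume "D f" "D g"
    then obtain u v w u' v' w' where *:
      "u \<in> forms (k - d)" "v \<in> forms (k - d)" "w \<in> forms (k - d)"
      "f = u * Var VX ^ d + v * Var VY ^ d + w * Var VZ ^ d"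
      "u' \<in> forms (k - d)" "v' \<in> forms (k - d)" "w' \<in> forms (k - d)"
      "g = u' * Var VX ^ d + v' * Var VY ^ d + w' * Var VZ ^ d"
      unfolding D_def by blast
    then show "D (f + g)"
      unfolding D_def
      by (intro bexI[of _ "u + u'"] bexI[of _ "v + v'"] bexI[of _ "w + w'"])
        (simp_all add: forms_add algebra_simps)
  next
    fix \<alpha> and c :: 'k
    assume \<alpha>: "\<alpha> \<in> Poly_Mapping.keys f"
    then obtain i where i: "d \<le> expo \<alpha> i"
      using assms(1) by (auto simp: power_ideal_iff)
    define t where "t = cmon (\<alpha> - Poly_Mapping.single i d) c"
    have eq: "cmon \<alpha> c = t * Var i ^ d"
      using i by (simp add: t_def term_eq_mult_Var_power)
    have "expo (\<alpha> - Poly_Mapping.single i d) j = expo \<alpha> j - (if i = j then d else 0)" for j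
      by (simp add: lookup_minus lookup_single when_def)
    then have "mdeg (\<alpha> - Poly_Mapping.single i d) = k - d"
      using i forms_key_mdeg[OF assms(2) \<alpha>] by (cases i) (simp_all add: mdeg_eq)
    then have t: "t \<in> forms (k - d)"
      unfolding t_def by (rule forms_cmon)
    have "t * Var i ^ d = (if i = VX then t else 0) * Var VX ^ d
        + (if i = VY then t else 0) * Var VY ^ d + (if i = VZ then t else 0) * Var VZ ^ d"
      by (cases i) simp_all
    moreover have "(if b then t else 0) \<in> forms (k - d)" for b
      using t by simp
    ultimately show "D (cmon \<alpha> c)"
      unfolding D_def eq by blast
  qed
  then show ?thesis
    by (simp add: D_def)
qed

text \<open>
  Restricting \<open>l * f = u X\<^sup>d + v Y\<^sup>d + w Z\<^sup>d\<close> to the line \<open>l = 0\<close> gives a syzygy of degree too low to be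
  nonzero.  So \<open>u\<close>, \<open>v\<close>, \<open>w\<close> vanish on the line, which makes them divisible by \<open>l\<close>; cancelling \<open>l\<close> exhibits
  \<open>f\<close> as an element of the ideal.
\<close>

lemma near_power_imp_injective:
  fixes l :: "'k::field poly3"
  assumes char2: "(1 :: 'k) + 1 = 0" and l: "l \<in> forms 1" and coeffs: "\<And>i. linear_coeffs l i \<noteq> 0"
    and d: "d \<ge> 2" "4 * 2 ^ k \<le> 3 * d + 1" "3 * d \<le> 4 * 2 ^ k + 1"
  shows "mult_injective d l ((3 * d - 4) div 2)"
  unfolding mult_injective_def
proof (intro ballI impI)
  define e where "e = (3 * d - 4) div 2"
  define n where "n = Suc e - d"
  define q :: nat where "q = 2 ^ k"
  define r where "r = d - q"
  have "q \<ge> 1"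
    by (simp add: q_def)
  have q: "d = q + r" "n < 2 * r" "n + r < q"
    using d \<open>q \<ge> 1\<close> unfolding q_def[symmetric] r_def n_def e_def by linarith+
  fix f assume "f \<in> forms ((3 * d - 4) div 2)" and lf: "l * f \<in> power_ideal d"
  then have f: "f \<in> forms e"
    by (simp add: e_def)
  have "l * f \<in> forms (Suc e)"
    using forms_mult[OF l f] by simp
  then obtain u v w where uvw: "u \<in> forms n" "v \<in> forms n" "w \<in> forms n"
      and lf_eq: "l * f = u * Var VX ^ d + v * Var VY ^ d + w * Var VZ ^ d"
    using power_ideal_form_decomposition[OF lf] unfolding n_def by blast
  let ?s = "subst_poly (line_param l)"
  let ?c = "\<lambda>i. inverse (linear_coeffs l i) ^ d"
  have "0 = ?s (l * f)"
    by (simp add: subst_poly_mult subst_poly_linear_form[OF char2 l coeffs])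
  also have "\<dots> = smult (?c VX) (?s u) * [:0, 1:] ^ d + smult (?c VY) (?s v)
      + smult (?c VZ) (?s w) * [:1, 1:] ^ d"
  proof -
    have "line_param l VX ^ d = smult (?c VX) ([:0, 1:] ^ d)" "line_param l VY ^ d = smult (?c VY) 1"
      "line_param l VZ ^ d = smult (?c VZ) ([:1, 1:] ^ d)"
      by (simp_all only: line_param_def var.case smult_power power_one)
    then show ?thesis
      unfolding lf_eq by (simp add: subst_poly_add subst_poly_mult subst_poly_Var_power)
  qed
  finally have syz: "smult (?c VX) (?s u) * [:0, 1:] ^ d + smult (?c VY) (?s v)
      + smult (?c VZ) (?s w) * [:1, 1:] ^ d = 0" ..
  have deg: "degree (smult c (?s g)) \<le> n" if "g \<in> forms n" for c g
    using degree_subst_poly_le[OF degree_line_param that] degree_smult_le by (rule le_trans[rotated])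
  have "smult (?c VX) (?s u) = 0 \<and> smult (?c VY) (?s v) = 0 \<and> smult (?c VZ) (?s w) = 0"
    by (rule no_low_degree_syzygy[OF char2 deg[OF uvw(1)] deg[OF uvw(2)] deg[OF uvw(3)] syz q_def q])
  then have "?s u = 0" "?s v = 0" "?s w = 0"
    using coeffs by simp_all
  then have "l dvd u" "l dvd v" "l dvd w"
    using linear_form_dvd[OF char2 l coeffs] uvw by blast+
  then obtain u' v' w' where "u = l * u'" "v = l * v'" "w = l * w'"
    by (auto simp: dvd_def)
  then have "l * f = l * (u' * Var VX ^ d + v' * Var VY ^ d + w' * Var VZ ^ d)"
    unfolding lf_eq by (simp add: algebra_simps)
  moreover have "l \<noteq> 0"
    using coeffs[of VX] by (auto simp: linear_coeffs_def)
  ultimately have "f = u' * Var VX ^ d + v' * Var VY ^ d + w' * Var VZ ^ d"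
    by simp
  then show "f \<in> power_ideal d"
    by (simp add: power_ideal_add power_ideal_mult Var_power_in_power_ideal)
qed

section \<open>The weak Lefschetz property\<close>

text \<open>
  The complement is the zero locus of the product of the three coordinates.
\<close>

lemma zariski_open_nonzero_coeffs:
  "zariski_open_linear {l :: 'k::field poly3. l \<in> forms 1 \<and> (\<forall>i. linear_coeffs l i \<noteq> 0)}"
proof -
  define \<mu> where "\<mu> = Poly_Mapping.single VX 1 + Poly_Mapping.single VY 1 + Poly_Mapping.single VZ (1 :: nat)"
  have expo: "expo \<mu> i = 1" for i
    by (cases i) (simp_all add: \<mu>_def lookup_add lookup_single)
  then have keys: "Poly_Mapping.keys \<mu> = UNIV"
    by (auto simp: in_keys_iff)
  have eval: "eval_poly (cmon \<mu> 1) v = (\<Prod>i\<in>UNIV. v i)" for v :: "var \<Rightarrow> 'k"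
    by (simp add: eval_poly_def keys expo)
  have "{l :: 'k poly3. l \<in> forms 1 \<and> (\<forall>i. linear_coeffs l i \<noteq> 0)}
      = forms 1 - {l \<in> forms 1. \<forall>p\<in>{cmon \<mu> 1}. eval_poly p (linear_coeffs l) = 0}"
    by (auto simp: eval)
  then show ?thesis
    unfolding zariski_open_linear_def by blast
qed

lemma exists_nonzero_coeffs:
  "{l :: 'k::field poly3. l \<in> forms 1 \<and> (\<forall>i. linear_coeffs l i \<noteq> 0)} \<noteq> {}"
proof -
  define l where "l = cmon (Poly_Mapping.single VX 1) (1 :: 'k)
    + cmon (Poly_Mapping.single VY 1) 1 + cmon (Poly_Mapping.single VZ 1) 1"
  have "l \<in> forms 1"
    unfolding l_def by (intro forms_add forms_cmon) simp_all
  moreover have "linear_coeffs l i = 1" for i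
    by (cases i) (simp_all add: l_def linear_coeffs_def lookup_add lookup_single single_var_eq_iff)
  ultimately show ?thesis
    by auto
qed

text \<open>
  The floor cuts off a remainder \<open>2 ^ t + 1 - 3 * d\<close> between \<open>0\<close> and \<open>2\<close>.
\<close>

lemma floor_condition_iff:
  "int d = \<lfloor>(2 ^ t + 1) / 3 :: real\<rfloor> \<longleftrightarrow> 3 * d \<le> 2 ^ t + 1 \<and> 2 ^ t \<le> 3 * d + 1"
proof -
  have "int d = \<lfloor>(2 ^ t + 1) / 3 :: real\<rfloor> \<longleftrightarrow> real d \<le> (2 ^ t + 1) / 3 \<and> (2 ^ t + 1) / 3 < real d + 1"
    using floor_eq_iff[of "(2 ^ t + 1) / 3 :: real" "int d"] by auto
  also have "\<dots> \<longleftrightarrow> real (3 * d) \<le> real (2 ^ t + 1) \<and> real (2 ^ t) < real (3 * d + 2)"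
    by (auto simp: field_simps)
  also have "\<dots> \<longleftrightarrow> 3 * d \<le> 2 ^ t + 1 \<and> 2 ^ t \<le> 3 * d + 1"
    unfolding of_nat_le_iff of_nat_less_iff by auto
  finally show ?thesis .
qed

theorem corollary2p7:
  fixes d :: nat
  assumes "CHAR('k::alg_closed_field) = 2"
    and "d \<ge> 1"
  shows "weak_lefschetz (power_ideal d :: 'k poly3 set) \<longleftrightarrow>
    (\<exists>t::nat. t > 0 \<and> int d = \<lfloor>(2 ^ t + 1) / 3 :: real\<rfloor>)"
  unfolding floor_condition_iff
proof
  have char2: "(1 :: 'k) + 1 = 0"
    using of_nat_CHAR[where ?'a = 'k] assms(1) by simp
  let ?I = "power_ideal d :: 'k poly3 set"
  {
    assume "weak_lefschetz ?I"
    then obtain s U where s: "\<And>m. m > s \<Longrightarrow> quot_component ?I m = {\<zero>\<^bsub>poly_ring Quot ?I\<^esub>}"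
      and U: "zariski_open_linear U" "U \<noteq> {}" "\<And>l m. l \<in> U \<Longrightarrow> m < s \<Longrightarrow> max_rank_at ?I l m"
      unfolding weak_lefschetz_def by blast
    from U obtain l where l: "l \<in> U" "l \<in> forms 1"
      by (auto simp: zariski_open_linear_def)
    have "s \<ge> 3 * (d - 1)"
    proof (rule ccontr)
      assume "\<not> s \<ge> 3 * (d - 1)"
      then have "forms (3 * (d - 1)) \<subseteq> ?I"
        using s by (simp flip: quot_component_zero_iff)
      moreover have "cmon (socle_monomial d) 1 \<in> forms (3 * (d - 1))"
        by (rule forms_cmon[OF mdeg_socle_monomial])
      ultimately show False
        using socle_term_notin_power_ideal[OF assms(2)] by blast
    qed
    then have max_rank: "\<forall>m<3 * (d - 1). max_rank_at ?I l m"
      using U(3)[OF l(1)] by simp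
    \<comment> \<open>Every linear form has the kernel elements found above, so one element of the open set is enough.\<close>
    show "\<exists>t>0. 3 * d \<le> 2 ^ t + 1 \<and> 2 ^ t \<le> 3 * d + 1"
    proof (cases "d = 1")
      case True
      then show ?thesis
        by (intro exI[of _ 1]) simp
    next
      case False
      with assms(2) have "d \<ge> 2"
        by simp
      then have inj: "mult_injective d l ((3 * d - 4) div 2)"
        using max_rank max_rank_all_iff l(2) by blast
      obtain n where n: "2 ^ n \<le> d" "d < 2 ^ (n + 1)"
        using ex_power_ivl1[of 2 d] assms(2) by auto
      then have "d \<le> 2 ^ Suc n"
        by simp
      from injective_imp_near_power[OF char2 l(2) \<open>d \<ge> 2\<close> n(1) this inj]
      show ?thesis
        by (intro exI[of _ "n + 2"]) (simp add: power_add)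
    qed
  }
  {
    assume "\<exists>t>0. 3 * d \<le> 2 ^ t + 1 \<and> 2 ^ t \<le> 3 * d + 1"
    then obtain t where t: "3 * d \<le> 2 ^ t + 1" "2 ^ t \<le> 3 * d + 1"
      by blast
    let ?U = "{l :: 'k poly3. l \<in> forms 1 \<and> (\<forall>i. linear_coeffs l i \<noteq> 0)}"
    have "quot_component ?I m = {\<zero>\<^bsub>poly_ring Quot ?I\<^esub>}" if "m > 3 * (d - 1)" for m
      using form_in_power_ideal_of_degree[OF assms(2) _ that] by (auto simp: quot_component_zero_iff)
    moreover have "max_rank_at ?I l m" if l: "l \<in> ?U" and m: "m < 3 * (d - 1)" for l m
    proof -
      have d: "d \<ge> 2"
        using m by simp
      \<comment> \<open>For \<open>d \<ge> 2\<close> the power \<open>2 ^ t\<close> is at least \<open>3 * d - 1 \<ge> 5\<close>, so it has the form \<open>4 * q\<close>.\<close>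
      have "t \<ge> 2"
      proof (rule ccontr)
        assume "\<not> t \<ge> 2"
        then have "t = 0 \<or> t = 1" by auto
        with t d show False by auto
      qed
      then obtain k where "t = 2 + k"
        using le_Suc_ex by blast
      then have "2 ^ t = 4 * (2 :: nat) ^ k"
        by (simp add: power_add)
      then have "mult_injective d l ((3 * d - 4) div 2)"
        using near_power_imp_injective[OF char2, of l d k] l d t by auto
      then show ?thesis
        using max_rank_all_iff[OF d, of l] l m by auto
    qed
    ultimately have "(\<forall>m>3 * (d - 1). quot_component ?I m = {\<zero>\<^bsub>poly_ring Quot ?I\<^esub>})
        \<and> zariski_open_linear ?U \<and> ?U \<noteq> {} \<and> (\<forall>l\<in>?U. \<forall>m<3 * (d - 1). max_rank_at ?I l m)"
      by (intro conjI zariski_open_nonzero_coeffs exists_nonzero_coeffs) blast+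
    then show "weak_lefschetz ?I"
      unfolding weak_lefschetz_def by (intro exI[of _ "3 * (d - 1)"] exI[of _ ?U] conjI) (elim conjE, assumption)+
  }
qed

end
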